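(* Let $K$ be a field, $S=K[x_1,\dots,x_m,y_1,\dots,y_n]$ the standard bigraded polynomial ring, $Q=(y_1,\dots,y_n)$, and $M$ a finitely generated bigraded $S$-module. Let $\mathcal{F}$ be a Cohen--Macaulay filtration of $M$ with respect to $Q$ and let $\mathcal{D}$ be the dimension filtration of $M$ with respect to $Q$. Then $\mathcal{F}=\mathcal{D}$.
   Context: $S$ is bigraded by $\deg x_i=(1,0)$ and $\deg y_j=(0,1)$ for all $i,j$. For a finitely generated bigraded $S$-module $M$, $\operatorname{cd}(Q,M)$ is the largest integer $i$ with $H^i_Q(M)\neq 0$; by convention $\operatorname{cd}(Q,0)=-\infty$. $M$ is Cohen--Macaulay with respect to $Q$ if exactly one local cohomology module $H^i_Q(M)$ is non-zero (equivalently, $\operatorname{grade}(Q,M)=\operatorname{cd}(Q,M)$). A Cohen--Macaulay filtration of $M$ with respect to $Q$ is a finite filtration $0=M_0\subsetneq M_1\subsetneq\dots\subsetneq M_r=M$ by bigraded submodules such that each quotient $M_i/M_{i-1}$ is Cohen--Macaulay with respect to $Q$ and $0\le \operatorname{cd}(Q,M_1/M_0)<\operatorname{cd}(Q,M_2/M_1)<\dots<\operatorname{cd}(Q,M_r/M_{r-1})$. The dimension filtration of $M$ with respect to $Q$ is the (unique) filtration $0=D_0\subsetneq D_1\subsetneq\dots\subsetneq D_s=M$ by bigraded submodules such that, for all $i=1,\dots,s$, $D_{i-1}$ is the largest bigraded submodule of $D_i$ with $\operatorname{cd}(Q,D_{i-1})<\operatorname{cd}(Q,D_i)$. Equality of filtrations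 means that they have the same length and the same terms. *)

theory Defs
  imports "HOL-Algebra.AbelCoset" "HOL-Algebra.Module"
    "HOL-Library.Poly_Mapping" "HOL-Library.Extended_Real" "HOL-Library.Product_Plus"
begin

section \<open>The bigraded polynomial ring\<close>

text \<open>
  A monomial is a finitely supported exponent function on the variables; the variable
  \<open>Inl i\<close> is x_{i+1} and \<open>Inr j\<close> is y_{j+1}.  The multiplication that
  \<^theory>\<open>HOL-Library.Poly_Mapping\<close> puts on the finitely supported maps from monomials to
  coefficients is convolution, i.e. multiplication of polynomials.
\<close>

type_synonym monom = "(nat + nat) \<Rightarrow>\<^sub>0 nat"

type_synonym 'k bipoly = "monom \<Rightarrow>\<^sub>0 'k"

definition bipoly_ring :: "nat \<Rightarrow> nat \<Rightarrow> ('k::field bipoly) ring" where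
  "bipoly_ring m n =
     \<lparr>carrier = {p. \<forall>t \<in> Poly_Mapping.keys p. Poly_Mapping.keys t \<subseteq> Inl ` {..<m} \<union> Inr ` {..<n}},
      monoid.mult = (*), one = 1, zero = 0, add = (+)\<rparr>"

definition xdeg :: "monom \<Rightarrow> nat" where
  "xdeg t = (\<Sum>v \<in> Poly_Mapping.keys t \<inter> range Inl. Poly_Mapping.lookup t v)"

definition ydeg :: "monom \<Rightarrow> nat" where
  "ydeg t = (\<Sum>v \<in> Poly_Mapping.keys t \<inter> range Inr. Poly_Mapping.lookup t v)"

definition bipoly_homog :: "nat \<Rightarrow> nat \<Rightarrow> int \<times> int \<Rightarrow> 'k::field bipoly set" where
  "bipoly_homog m n d =
     {p \<in> carrier (bipoly_ring m n). \<forall>t \<in> Poly_Mapping.keys p. (int (xdeg t), int (ydeg t)) = d}"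

definition yvar :: "nat \<Rightarrow> 'k::field bipoly" where
  "yvar j = Poly_Mapping.single (Poly_Mapping.single (Inr j) 1) 1"

definition Q_gens :: "nat \<Rightarrow> 'k::field bipoly list" where
  "Q_gens n = map yvar [0..<n]"


section \<open>Modules\<close>

text \<open>
  The fields \<open>mult\<close> and \<open>one\<close> that the record type of modules inherits from rings carry no
  meaning for modules and are left unspecified.
\<close>

definition module_quot :: "('a, 'b, 'c) module_scheme \<Rightarrow> 'b set \<Rightarrow> ('a, 'b set) module" where
  "module_quot M N =
     \<lparr>carrier = a_rcosets\<^bsub>M\<^esub> N, monoid.mult = undefined, one = undefined,
      zero = N, add = (\<lambda>X Y. X <+>\<^bsub>M\<^esub> Y),
      smult = (\<lambda>a X. \<Union>x\<in>X. N +>\<^bsub>M\<^esub> (a \<odot>\<^bsub>M\<^esub> x))\<rparr>"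

definition fin_gen_module :: "('a, 'c) ring_scheme \<Rightarrow> ('a, 'b, 'd) module_scheme \<Rightarrow> bool" where
  "fin_gen_module R M \<longleftrightarrow>
     (\<exists>A. finite A \<and> A \<subseteq> carrier M \<and> \<Inter>{N. submodule N R M \<and> A \<subseteq> N} = carrier M)"

text \<open>
  \<open>G d\<close> is the homogeneous component of \<open>M\<close> of bidegree \<open>d\<close>; the last conjunct says that
  \<open>M\<close> is the internal direct sum of the components.
\<close>

definition bigraded_module ::
    "nat \<Rightarrow> nat \<Rightarrow> ('k::field bipoly, 'b) module \<Rightarrow> (int \<times> int \<Rightarrow> 'b set) \<Rightarrow> bool" where
  "bigraded_module m n M G \<longleftrightarrow>
     Module.module (bipoly_ring m n) M \<and>
     (\<forall>d. subgroup (G d) (add_monoid M)) \<and>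
     (\<forall>d e. \<forall>p \<in> bipoly_homog m n d. \<forall>u \<in> G e. p \<odot>\<^bsub>M\<^esub> u \<in> G (d + e)) \<and>
     (\<forall>u \<in> carrier M. \<exists>!c. (\<forall>d. c d \<in> G d) \<and> finite {d. c d \<noteq> \<zero>\<^bsub>M\<^esub>} \<and>
        u = (\<Oplus>\<^bsub>M\<^esub>d \<in> {d. c d \<noteq> \<zero>\<^bsub>M\<^esub>}. c d))"

definition bigraded_submodule ::
    "nat \<Rightarrow> nat \<Rightarrow> ('k::field bipoly, 'b) module \<Rightarrow> (int \<times> int \<Rightarrow> 'b set) \<Rightarrow> 'b set \<Rightarrow> bool" where
  "bigraded_submodule m n M G N \<longleftrightarrow>
     submodule N (bipoly_ring m n) M \<and>
     (\<forall>u \<in> N. \<exists>c. (\<forall>d. c d \<in> N \<inter> G d) \<and> finite {d. c d \<noteq> \<zero>\<^bsub>M\<^esub>} \<and>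
        u = (\<Oplus>\<^bsub>M\<^esub>d \<in> {d. c d \<noteq> \<zero>\<^bsub>M\<^esub>}. c d))"


section \<open>Localization at the powers of an element\<close>

text \<open>
  \<open>loc_frac R M f u k\<close> is the fraction u/f^k: the class of all pairs (v, l) such that
  f^t (f^l u - f^k v) = 0 for some t.
\<close>

definition loc_frac ::
    "('a, 'c) ring_scheme \<Rightarrow> ('a, 'b, 'd) module_scheme \<Rightarrow> 'a \<Rightarrow> 'b \<Rightarrow> nat \<Rightarrow> ('b \<times> nat) set" where
  "loc_frac R M f u k =
     {(v, l). v \<in> carrier M \<and>
        (\<exists>t::nat. (f [^]\<^bsub>R\<^esub> (t + l)) \<odot>\<^bsub>M\<^esub> u = (f [^]\<^bsub>R\<^esub> (t + k)) \<odot>\<^bsub>M\<^esub> v)}"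

definition localization ::
    "('a, 'c) ring_scheme \<Rightarrow> ('a, 'b, 'd) module_scheme \<Rightarrow> 'a \<Rightarrow> ('a, ('b \<times> nat) set) module" where
  "localization R M f =
     \<lparr>carrier = {loc_frac R M f u k | u k. u \<in> carrier M},
      monoid.mult = undefined, one = undefined,
      zero = loc_frac R M f \<zero>\<^bsub>M\<^esub> 0,
      add = (\<lambda>X Y. \<Union>(u, k) \<in> X. \<Union>(v, l) \<in> Y.
               loc_frac R M f ((f [^]\<^bsub>R\<^esub> l) \<odot>\<^bsub>M\<^esub> u \<oplus>\<^bsub>M\<^esub> (f [^]\<^bsub>R\<^esub> k) \<odot>\<^bsub>M\<^esub> v) (k + l)),
      smult = (\<lambda>a X. \<Union>(u, k) \<in> X. loc_frac R M f (a \<odot>\<^bsub>M\<^esub> u) k)\<rparr>"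


section \<open>Local cohomology\<close>

text \<open>
  The local cohomology of a module \<open>M\<close> with respect to the ideal generated by the list
  \<open>ys\<close> = (y_0, ..., y_{r-1}) of elements of \<open>R\<close> is the cohomology of the extended Cech complex
  \<open>0 \<rightarrow> M \<rightarrow> \<Oplus>\<^sub>j M\<^bsub>y_j\<^esub> \<rightarrow> \<Oplus>\<^bsub>j<k\<^esub> M\<^bsub>y_j y_k\<^esub> \<rightarrow> \<dots> \<rightarrow> M\<^bsub>y_0 \<cdots> y_{r-1}\<^esub> \<rightarrow> 0\<close>.
  Its term in degree \<open>i\<close> is the direct sum, over the \<open>i\<close>-element sets \<open>J\<close> of indices, of the
  localizations of \<open>M\<close> at the product of the y_j with j in \<open>J\<close>.  For \<open>J\<close> empty this is the
  localization at 1, that is, \<open>M\<close> itself.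
\<close>

definition cech_index :: "'a list \<Rightarrow> nat \<Rightarrow> nat set set" where
  "cech_index ys i = {J. J \<subseteq> {..<length ys} \<and> card J = i}"

definition cech_prod :: "('a, 'c) ring_scheme \<Rightarrow> 'a list \<Rightarrow> nat set \<Rightarrow> 'a" where
  "cech_prod R ys J = (\<Otimes>\<^bsub>R\<^esub>j \<in> J. ys ! j)"

definition cech_loc ::
    "('a, 'c) ring_scheme \<Rightarrow> 'a list \<Rightarrow> ('a, 'b, 'd) module_scheme \<Rightarrow> nat set \<Rightarrow>
      ('a, ('b \<times> nat) set) module" where
  "cech_loc R ys M J = localization R M (cech_prod R ys J)"

definition cech_module ::
    "('a, 'c) ring_scheme \<Rightarrow> 'a list \<Rightarrow> ('a, 'b, 'd) module_scheme \<Rightarrow> nat \<Rightarrow>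
      ('a, nat set \<Rightarrow> ('b \<times> nat) set) module" where
  "cech_module R ys M i =
     \<lparr>carrier = (\<Pi>\<^sub>E J \<in> cech_index ys i. carrier (cech_loc R ys M J)),
      monoid.mult = undefined, one = undefined,
      zero = (\<lambda>J \<in> cech_index ys i. \<zero>\<^bsub>cech_loc R ys M J\<^esub>),
      add = (\<lambda>c d. \<lambda>J \<in> cech_index ys i. c J \<oplus>\<^bsub>cech_loc R ys M J\<^esub> d J),
      smult = (\<lambda>a c. \<lambda>J \<in> cech_index ys i. a \<odot>\<^bsub>cech_loc R ys M J\<^esub> c J)\<rparr>"

text \<open>
  For \<open>j \<notin> J\<close> the canonical map from the localization for \<open>J\<close> to the one for \<open>J \<union> {j}\<close> sends
  u / (y_J)^k to (y_j)^k u / (y_j y_J)^k, where y_J is the product over \<open>J\<close>.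
\<close>

definition cech_res ::
    "('a, 'c) ring_scheme \<Rightarrow> 'a list \<Rightarrow> ('a, 'b, 'd) module_scheme \<Rightarrow> nat set \<Rightarrow> nat \<Rightarrow>
      ('b \<times> nat) set \<Rightarrow> ('b \<times> nat) set" where
  "cech_res R ys M J j X =
     (\<Union>(u, k) \<in> X. loc_frac R M (cech_prod R ys (insert j J)) (((ys ! j) [^]\<^bsub>R\<^esub> k) \<odot>\<^bsub>M\<^esub> u) k)"

definition cech_diff ::
    "('a, 'c) ring_scheme \<Rightarrow> 'a list \<Rightarrow> ('a, 'b, 'd) module_scheme \<Rightarrow> nat \<Rightarrow>
      (nat set \<Rightarrow> ('b \<times> nat) set) \<Rightarrow> (nat set \<Rightarrow> ('b \<times> nat) set)" where
  "cech_diff R ys M i c =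
     (\<lambda>J \<in> cech_index ys (Suc i).
        \<Oplus>\<^bsub>cech_loc R ys M J\<^esub>j \<in> J.
          (if even (card {l \<in> J. l < j})
           then cech_res R ys M (J - {j}) j (c (J - {j}))
           else \<ominus>\<^bsub>cech_loc R ys M J\<^esub> cech_res R ys M (J - {j}) j (c (J - {j}))))"

definition cech_cocycles ::
    "('a, 'c) ring_scheme \<Rightarrow> 'a list \<Rightarrow> ('a, 'b, 'd) module_scheme \<Rightarrow> nat \<Rightarrow>
      (nat set \<Rightarrow> ('b \<times> nat) set) set" where
  "cech_cocycles R ys M i =
     {c \<in> carrier (cech_module R ys M i). cech_diff R ys M i c = \<zero>\<^bsub>cech_module R ys M (Suc i)\<^esub>}"

definition cech_coboundaries ::
    "('a, 'c) ring_scheme \<Rightarrow> 'a list \<Rightarrow> ('a, 'b, 'd) module_scheme \<Rightarrow> nat \<Rightarrow>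
      (nat set \<Rightarrow> ('b \<times> nat) set) set" where
  "cech_coboundaries R ys M i =
     (case i of 0 \<Rightarrow> {\<zero>\<^bsub>cech_module R ys M 0\<^esub>}
      | Suc k \<Rightarrow> cech_diff R ys M k ` carrier (cech_module R ys M k))"

definition local_cohomology ::
    "('a, 'c) ring_scheme \<Rightarrow> 'a list \<Rightarrow> ('a, 'b, 'd) module_scheme \<Rightarrow> nat \<Rightarrow>
      ('a, (nat set \<Rightarrow> ('b \<times> nat) set) set) module" where
  "local_cohomology R ys M i =
     module_quot ((cech_module R ys M i)\<lparr>carrier := cech_cocycles R ys M i\<rparr>)
       (cech_coboundaries R ys M i)"

definition lc_nonzero ::
    "('a, 'c) ring_scheme \<Rightarrow> 'a list \<Rightarrow> ('a, 'b, 'd) module_scheme \<Rightarrow> nat \<Rightarrow> bool" where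
  "lc_nonzero R ys M i \<longleftrightarrow>
     carrier (local_cohomology R ys M i) \<noteq> {\<zero>\<^bsub>local_cohomology R ys M i\<^esub>}"

text \<open>
  The supremum is over a subset of \<open>{0..length ys}\<close>, hence a maximum unless all local cohomology
  vanishes; in that case (in particular for the zero module) its value is \<open>-\<infinity>\<close>.
\<close>

definition cd ::
    "('a, 'c) ring_scheme \<Rightarrow> 'a list \<Rightarrow> ('a, 'b, 'd) module_scheme \<Rightarrow> ereal" where
  "cd R ys M = Sup {ereal (real i) | i. lc_nonzero R ys M i}"

definition relative_CM ::
    "('a, 'c) ring_scheme \<Rightarrow> 'a list \<Rightarrow> ('a, 'b, 'd) module_scheme \<Rightarrow> bool" where
  "relative_CM R ys M \<longleftrightarrow> (\<exists>!i. lc_nonzero R ys M i)"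


section \<open>Filtrations with respect to Q\<close>

text \<open>
  A filtration with terms F_0, ..., F_r is the list \<open>[F_0, \<dots>, F_r]\<close>, so that equality of
  filtrations is equality of lists.
\<close>

definition bigraded_filtration ::
    "nat \<Rightarrow> nat \<Rightarrow> ('k::field bipoly, 'b) module \<Rightarrow> (int \<times> int \<Rightarrow> 'b set) \<Rightarrow> 'b set list \<Rightarrow> bool" where
  "bigraded_filtration m n M G F \<longleftrightarrow>
     F \<noteq> [] \<and> F ! 0 = {\<zero>\<^bsub>M\<^esub>} \<and> last F = carrier M \<and>
     (\<forall>i < length F. bigraded_submodule m n M G (F ! i)) \<and>
     (\<forall>i. Suc i < length F \<longrightarrow> F ! i \<subset> F ! Suc i)"

definition cd_Q :: "nat \<Rightarrow> nat \<Rightarrow> ('k::field bipoly, 'b) module \<Rightarrow> ereal" where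
  "cd_Q m n M = cd (bipoly_ring m n) (Q_gens n) M"

definition CM_Q :: "nat \<Rightarrow> nat \<Rightarrow> ('k::field bipoly, 'b) module \<Rightarrow> bool" where
  "CM_Q m n M \<longleftrightarrow> relative_CM (bipoly_ring m n) (Q_gens n) M"

text \<open>\<open>filt_quot M F i\<close> is the quotient F_{i+1} / F_i.\<close>

definition filt_quot :: "('a, 'b) module \<Rightarrow> 'b set list \<Rightarrow> nat \<Rightarrow> ('a, 'b set) module" where
  "filt_quot M F i = module_quot (M\<lparr>carrier := F ! Suc i\<rparr>) (F ! i)"

definition CM_filtration ::
    "nat \<Rightarrow> nat \<Rightarrow> ('k::field bipoly, 'b) module \<Rightarrow> (int \<times> int \<Rightarrow> 'b set) \<Rightarrow> 'b set list \<Rightarrow> bool" where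
  "CM_filtration m n M G F \<longleftrightarrow>
     bigraded_filtration m n M G F \<and>
     (\<forall>i. Suc i < length F \<longrightarrow> CM_Q m n (filt_quot M F i)) \<and>
     (Suc 0 < length F \<longrightarrow> 0 \<le> cd_Q m n (filt_quot M F 0)) \<and>
     (\<forall>i. Suc (Suc i) < length F \<longrightarrow>
        cd_Q m n (filt_quot M F i) < cd_Q m n (filt_quot M F (Suc i)))"

definition dimension_filtration ::
    "nat \<Rightarrow> nat \<Rightarrow> ('k::field bipoly, 'b) module \<Rightarrow> (int \<times> int \<Rightarrow> 'b set) \<Rightarrow> 'b set list \<Rightarrow> bool" where
  "dimension_filtration m n M G D \<longleftrightarrow>
     bigraded_filtration m n M G D \<and>
     (\<forall>i. Suc i < length D \<longrightarrow>
        cd_Q m n (M\<lparr>carrier := D ! i\<rparr>) < cd_Q m n (M\<lparr>carrier := D ! Suc i\<rparr>) \<and>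
        (\<forall>N. bigraded_submodule m n M G N \<longrightarrow> N \<subseteq> D ! Suc i \<longrightarrow>
           cd_Q m n (M\<lparr>carrier := N\<rparr>) < cd_Q m n (M\<lparr>carrier := D ! Suc i\<rparr>) \<longrightarrow> N \<subseteq> D ! i))"

end

theory Submission
  imports Defs
begin

text \<open>
  Write c_p for the cohomological dimension of the quotient F_{p+1} / F_p of the Cohen--Macaulay
  filtration.  The filtrations are compared from the top.  Both end in the whole module, and if
  F_{p+1} = D_{q+1} then F_p = D_q, for two reasons.  As cd F_{p+1} = c_p increases with p, F_p has
  smaller dimension than F_{p+1} = D_{q+1}, so that it lies in D_q by the maximality of D_q.
  Conversely cd D_q < c_p, while the local cohomology of F_{p+1} / F_p vanishes below degree c_p; such
  a gap forces the map from D_q to F_{p+1} / F_p to vanish.  Strictness of the inclusions makes both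
  filtrations reach 0 at the same time.

  The gap argument is the heart of the matter.  Let \<open>\<phi> : N \<rightarrow> P\<close> be a homomorphism, with
  H^i(N) = 0 for \<open>i \<ge> c\<close> and H^i(P) = 0 for \<open>i < c\<close>.  In the derived category \<open>R\<Gamma>(\<phi>)\<close> goes from a
  complex in degrees below c to one in degrees at least c, so it is zero.  Taking Koszul homology
  with respect to y_1^T, ..., y_n^T turns it into the map N / (y^T) N \<open>\<rightarrow>\<close> P / (y^T) P, which is
  therefore zero for every T: the image of \<open>\<phi>\<close> lies in the intersection of all (y^T) P.  When P is
  the quotient of two bigraded submodules of a finitely generated bigraded module, y-degrees are
  bounded below and this intersection is 0.  That cd F_{p+1} is at most c_p follows from the long exact
  sequence; it is at least c_p by the same gap argument, applied to the projection
  F_{p+1} \<open>\<rightarrow>\<close> F_{p+1} / F_p.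

  This can be carried out with elements of the modules.  Clearing denominators turns a Cech cocycle
  into a cocycle of the Koszul complex of y_1^k, ..., y_n^k for some k, so that the vanishing of
  H^i becomes a statement about families of module elements (\<open>lc_zero_iff_koszul_exact\<close>).
  For x in N the elements x e_I form a chain map from the Koszul complex of y^T over the ring to the
  one of N, and a null homotopy for it is built degree by degree, downwards: the vanishing
  for N is used in the degrees from c on, that for P below c (\<open>hom_image_in_power_submodule\<close>).
  Its value in the lowest degree exhibits \<open>\<phi> x\<close> as a combination of the y_j^T.  The vanishing of
  the middle term of the long exact sequence between two vanishing ones is proved with
  representatives (\<open>koszul_exact_extension\<close>).
\<close>


section \<open>Finite sums in abelian groups\<close>

lemma (in abelian_group) finsum_minus:
  assumes "finite X" "f \<in> X \<rightarrow> carrier G"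
  shows "\<ominus> (\<Oplus>j\<in>X. f j) = (\<Oplus>j\<in>X. \<ominus> f j)"
  using assms by (induction X) (auto simp: Pi_def minus_add)

text \<open>
  Exchanging the two indices only shows that the sum is its own negative, which leaves 2-torsion.
  Induction on the index set cancels a new row against the new column instead.
\<close>

lemma (in abelian_group) antisymmetric_finsum_eq_zero:
  assumes "finite X"
    and "\<And>j l. j \<in> X \<Longrightarrow> l \<in> X \<Longrightarrow> j \<noteq> l \<Longrightarrow> f j l \<in> carrier G"
    and "\<And>j l. j \<in> X \<Longrightarrow> l \<in> X \<Longrightarrow> j \<noteq> l \<Longrightarrow> f j l = \<ominus> f l j"
  shows "(\<Oplus>j\<in>X. \<Oplus>l\<in>X - {j}. f j l) = \<zero>"
  using assms
proof (induction X)
  case empty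
  show ?case by simp
next
  case (insert x X)
  have c: "f j x \<in> carrier G" "f x j \<in> carrier G" if "j \<in> X" for j
    using that insert.prems(1) insert.hyps(2) by auto
  have c': "f j l \<in> carrier G" if "j \<in> X" "l \<in> X" "j \<noteq> l" for j l
    using that insert.prems(1) by auto
  have inner: "(\<Oplus>l\<in>insert x X - {j}. f j l) = f j x \<oplus> (\<Oplus>l\<in>X - {j}. f j l)" if "j \<in> X" for j
  proof -
    have "insert x X - {j} = insert x (X - {j})" using that insert.hyps(2) by auto
    moreover have "f j \<in> X - {j} \<rightarrow> carrier G" using that c' by auto
    ultimately show ?thesis
      using that insert.hyps c by (simp add: finsum_insert)
  qed
  have IH: "(\<Oplus>j\<in>X. \<Oplus>l\<in>X - {j}. f j l) = \<zero>"
    by (rule insert.IH) (rule insert.prems; simp)+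
  have s: "(\<Oplus>l\<in>X - {j}. f j l) \<in> carrier G" if "j \<in> X" for j
    using that c' by (intro finsum_closed) auto
  have "(\<Oplus>j\<in>X. \<Oplus>l\<in>insert x X - {j}. f j l) = (\<Oplus>j\<in>X. f j x \<oplus> (\<Oplus>l\<in>X - {j}. f j l))"
    using inner c s by (intro finsum_cong') auto
  also have "\<dots> = (\<Oplus>j\<in>X. f j x) \<oplus> (\<Oplus>j\<in>X. \<Oplus>l\<in>X - {j}. f j l)"
    using c s by (intro finsum_addf) auto
  also have "\<dots> = (\<Oplus>j\<in>X. f j x)"
    using c IH by (simp add: Pi_def)
  also have "\<dots> = (\<Oplus>j\<in>X. \<ominus> f x j)"
  proof (rule finsum_cong')
    show "f j x = \<ominus> f x j" if "j \<in> X" for j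
      using that insert.hyps(2) by (intro insert.prems(2)) auto
  qed (use c in auto)
  also have "\<dots> = \<ominus> (\<Oplus>j\<in>X. f x j)"
    using c insert.hyps by (intro finsum_minus[symmetric]) auto
  finally have rest: "(\<Oplus>j\<in>X. \<Oplus>l\<in>insert x X - {j}. f j l) = \<ominus> (\<Oplus>j\<in>X. f x j)" .
  have first: "insert x X - {x} = X" using insert.hyps(2) by auto
  have "(\<Oplus>j\<in>insert x X. \<Oplus>l\<in>insert x X - {j}. f j l)
      = (\<Oplus>l\<in>X. f x l) \<oplus> (\<Oplus>j\<in>X. \<Oplus>l\<in>insert x X - {j}. f j l)"
    using insert.hyps c s inner by (subst finsum_insert) (auto simp: first)
  also have "\<dots> = \<zero>"
    using rest c by (simp add: Pi_def r_neg)
  finally show ?case .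
qed

lemma finsum_hom:
  assumes "abelian_group G" "abelian_group H" "finite X" "f \<in> X \<rightarrow> carrier G"
    and "\<phi> \<in> carrier G \<rightarrow> carrier H"
    and "\<And>x y. x \<in> carrier G \<Longrightarrow> y \<in> carrier G \<Longrightarrow> \<phi> (x \<oplus>\<^bsub>G\<^esub> y) = \<phi> x \<oplus>\<^bsub>H\<^esub> \<phi> y"
  shows "\<phi> (\<Oplus>\<^bsub>G\<^esub>j\<in>X. f j) = (\<Oplus>\<^bsub>H\<^esub>j\<in>X. \<phi> (f j))"
proof -
  interpret G: abelian_group G by fact
  interpret H: abelian_group H by fact
  have c: "\<phi> x \<in> carrier H" if "x \<in> carrier G" for x
    using that assms(5) by auto
  have "\<phi> \<zero>\<^bsub>G\<^esub> \<oplus>\<^bsub>H\<^esub> \<phi> \<zero>\<^bsub>G\<^esub> = \<phi> \<zero>\<^bsub>G\<^esub>"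
    using assms(6)[of "\<zero>\<^bsub>G\<^esub>" "\<zero>\<^bsub>G\<^esub>"] by simp
  then have z: "\<phi> \<zero>\<^bsub>G\<^esub> = \<zero>\<^bsub>H\<^esub>"
    by (metis H.add.l_cancel_one' G.zero_closed c)
  show ?thesis
    using assms(3,4)
  proof (induction X)
    case empty
    then show ?case using z by simp
  next
    case (insert x X)
    have "f x \<in> carrier G" "f \<in> X \<rightarrow> carrier G" using insert.prems by auto
    then show ?case
      using insert by (simp add: assms(6) c Pi_def G.finsum_closed)
  qed
qed


section \<open>The Koszul complex of powers of a sequence\<close>

locale module_sequence = Module.module R M for R (structure) and M (structure) +
  fixes ys :: "'a list"
  assumes ys_closed: "set ys \<subseteq> carrier R"
begin

definition idx :: "nat set" where
  "idx = {..<length ys}"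

abbreviation yprod :: "nat set \<Rightarrow> 'a" where
  "yprod J \<equiv> cech_prod R ys J"

abbreviation deg :: "nat \<Rightarrow> nat set set" where
  "deg i \<equiv> cech_index ys i"

definition cochains :: "(nat set \<Rightarrow> 'c) set" where
  "cochains = Pow idx \<rightarrow> carrier M"

text \<open>
  The sign of j relative to J only depends on the elements of J below j.  It is therefore the same
  for a set with and without j, which is why one definition serves both for removing j from a
  set and for adding it.
\<close>

definition signed_power :: "nat \<Rightarrow> nat set \<Rightarrow> nat \<Rightarrow> 'a" where
  "signed_power k J j =
     (if even (card {l \<in> J. l < j}) then (ys ! j) [^] k else \<ominus> ((ys ! j) [^] k))"

text \<open>
  An element of the Koszul complex of the powers y_j^k with values in M is a function on sets of
  indices; all degrees are kept in one function, and degree i concerns its values on the sets with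
  i elements.
\<close>

definition koszul_diff :: "nat \<Rightarrow> (nat set \<Rightarrow> 'c) \<Rightarrow> nat set \<Rightarrow> 'c" where
  "koszul_diff k u J = (\<Oplus>\<^bsub>M\<^esub>j\<in>J. signed_power k J j \<odot>\<^bsub>M\<^esub> u (J - {j}))"

text \<open>
  The differential of the Koszul complex of y_j^k over the ring sends a basis vector e_I to the
  signed sum of the y_j^k e_{I \<open>\<union>\<close> j}.  If u is seen as the values on basis vectors of a linear map,
  this is the composite of that map with the differential.
\<close>

definition koszul_codiff :: "nat \<Rightarrow> (nat set \<Rightarrow> 'c) \<Rightarrow> nat set \<Rightarrow> 'c" where
  "koszul_codiff k u I = (\<Oplus>\<^bsub>M\<^esub>j\<in>idx - I. signed_power k I j \<odot>\<^bsub>M\<^esub> u (insert j I))"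

text \<open>
  Multiplying the component at J by the t-th power of y_J is the transition map from the Koszul
  complex of y^k to that of y^{k+t}, and the Cech complex is the colimit of these complexes.  The
  condition says that every Koszul cocycle of degree i becomes a coboundary at a later stage, i.e.
  that the colimit has no cohomology in degree i.
\<close>

definition koszul_exact :: "nat \<Rightarrow> bool" where
  "koszul_exact i \<longleftrightarrow>
     (\<forall>k. \<forall>u\<in>cochains. (\<forall>J\<in>deg (Suc i). koszul_diff k u J = \<zero>\<^bsub>M\<^esub>) \<longrightarrow>
        (\<exists>t. \<exists>v\<in>cochains. \<forall>J\<in>deg i. yprod J [^] t \<odot>\<^bsub>M\<^esub> u J = koszul_diff (k + t) v J))"

lemma finite_idx [simp]: "finite idx"
  by (simp add: idx_def)

lemma deg_iff: "J \<in> deg i \<longleftrightarrow> J \<subseteq> idx \<and> card J = i"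
  by (simp add: cech_index_def idx_def)

lemma finite_deg [simp]: "finite (deg i)"
  by (rule finite_subset[of _ "Pow idx"]) (auto simp: deg_iff)

lemma diff_subset_idx [simp, intro]: "J \<subseteq> idx \<Longrightarrow> J - X \<subseteq> idx"
  by auto

lemma finite_subset_idx: "J \<subseteq> idx \<Longrightarrow> finite J"
  using finite_idx by (rule finite_subset[rotated])

lemma ys_nth_closed [simp, intro]: "j \<in> idx \<Longrightarrow> ys ! j \<in> carrier R"
  using ys_closed nth_mem by (fastforce simp: idx_def)

lemma yprod_closed [simp, intro]: "J \<subseteq> idx \<Longrightarrow> yprod J \<in> carrier R"
  unfolding cech_prod_def by (rule R.finprod_closed) auto

lemma yprod_remove:
  assumes "J \<subseteq> idx" "j \<in> J"
  shows "yprod J = ys ! j \<otimes> yprod (J - {j})"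
proof -
  have "J = insert j (J - {j})" using assms by auto
  then have "yprod J = (\<Otimes>l\<in>insert j (J - {j}). ys ! l)"
    by (simp add: cech_prod_def)
  also have "\<dots> = ys ! j \<otimes> yprod (J - {j})"
    using assms finite_subset_idx[of J] unfolding cech_prod_def
    by (subst R.finprod_insert) auto
  finally show ?thesis .
qed

lemma signed_power_closed [simp, intro]: "j \<in> idx \<Longrightarrow> signed_power k J j \<in> carrier R"
  by (simp add: signed_power_def)

lemma cochainsD [simp, intro]: "u \<in> cochains \<Longrightarrow> J \<subseteq> idx \<Longrightarrow> u J \<in> carrier M"
  by (auto simp: cochains_def)

lemma cochainsI: "(\<And>J. J \<subseteq> idx \<Longrightarrow> u J \<in> carrier M) \<Longrightarrow> u \<in> cochains"
  by (auto simp: cochains_def)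

lemma koszul_diff_closed [simp, intro]:
  "u \<in> cochains \<Longrightarrow> J \<subseteq> idx \<Longrightarrow> koszul_diff k u J \<in> carrier M"
  unfolding koszul_diff_def by (rule M.finsum_closed) auto

lemma koszul_codiff_closed [simp, intro]:
  "u \<in> cochains \<Longrightarrow> I \<subseteq> idx \<Longrightarrow> koszul_codiff k u I \<in> carrier M"
  unfolding koszul_codiff_def by (rule M.finsum_closed) auto

lemma signed_power_add:
  "j \<in> idx \<Longrightarrow> signed_power (k + t) J j = signed_power k J j \<otimes> (ys ! j) [^] t"
  by (simp add: signed_power_def R.nat_pow_mult R.l_minus)

lemma signed_power_anticommute:
  assumes "J \<subseteq> idx" "j \<in> J" "l \<in> J" "j \<noteq> l"
  shows "signed_power k J j \<otimes> signed_power k (J - {j}) l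
       = \<ominus> (signed_power k J l \<otimes> signed_power k (J - {l}) j)"
proof -
  have main: "signed_power k J j \<otimes> signed_power k (J - {j}) l
       = \<ominus> (signed_power k J l \<otimes> signed_power k (J - {l}) j)"
    if jl: "j \<in> J" "l \<in> J" "j < l" for j l
  proof -
    have "{a \<in> J - {l}. a < j} = {a \<in> J. a < j}" using jl by auto
    then have 1: "signed_power k (J - {l}) j = signed_power k J j"
      unfolding signed_power_def by simp
    have "{a \<in> J. a < l} = insert j {a \<in> J - {j}. a < l}" using jl by auto
    moreover have "finite {a \<in> J - {j}. a < l}" by simp
    ultimately have "card {a \<in> J. a < l} = Suc (card {a \<in> J - {j}. a < l})" by simp
    moreover have l: "ys ! l \<in> carrier R" using assms jl by auto
    ultimately have 2: "signed_power k (J - {j}) l = \<ominus> signed_power k J l"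
      unfolding signed_power_def by auto
    have c: "signed_power k J j \<in> carrier R" "signed_power k J l \<in> carrier R"
      using assms jl by auto
    show ?thesis
      using c unfolding 1 2 by (simp add: R.r_minus R.m_comm)
  qed
  show ?thesis
  proof (cases "j < l")
    case True
    then show ?thesis using main assms by blast
  next
    case False
    then have "signed_power k J l \<otimes> signed_power k (J - {l}) j
       = \<ominus> (signed_power k J j \<otimes> signed_power k (J - {j}) l)"
      using main[of l j] assms by simp
    then show ?thesis
      using assms by (simp add: subset_iff)
  qed
qed

lemma koszul_diff_cong:
  assumes "J \<subseteq> idx" "u \<in> cochains" "\<And>j. j \<in> J \<Longrightarrow> u' (J - {j}) = u (J - {j})"
  shows "koszul_diff k u' J = koszul_diff k u J"
  unfolding koszul_diff_def using assms by (intro M.finsum_cong') auto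

lemma koszul_codiff_cong:
  assumes "I \<subseteq> idx" "u \<in> cochains" "\<And>j. j \<in> idx - I \<Longrightarrow> u' (insert j I) = u (insert j I)"
  shows "koszul_codiff k u' I = koszul_codiff k u I"
  unfolding koszul_codiff_def using assms by (intro M.finsum_cong') auto

lemma koszul_diff_add:
  assumes "u \<in> cochains" "v \<in> cochains" "J \<subseteq> idx"
  shows "koszul_diff k (\<lambda>J. u J \<oplus>\<^bsub>M\<^esub> v J) J = koszul_diff k u J \<oplus>\<^bsub>M\<^esub> koszul_diff k v J"
proof -
  have "koszul_diff k (\<lambda>J. u J \<oplus>\<^bsub>M\<^esub> v J) J
      = (\<Oplus>\<^bsub>M\<^esub>j\<in>J. signed_power k J j \<odot>\<^bsub>M\<^esub> u (J - {j}) \<oplus>\<^bsub>M\<^esub> signed_power k J j \<odot>\<^bsub>M\<^esub> v (J - {j}))"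
    unfolding koszul_diff_def using assms by (intro M.finsum_cong') (auto intro!: smult_r_distr)
  then show ?thesis
    unfolding koszul_diff_def using assms by (subst M.finsum_addf[symmetric]) auto
qed

lemma koszul_diff_smult:
  assumes "u \<in> cochains" "a \<in> carrier R" "J \<subseteq> idx"
  shows "koszul_diff k (\<lambda>J. a \<odot>\<^bsub>M\<^esub> u J) J = a \<odot>\<^bsub>M\<^esub> koszul_diff k u J"
proof -
  have "a \<odot>\<^bsub>M\<^esub> koszul_diff k u J
      = (\<Oplus>\<^bsub>M\<^esub>j\<in>J. a \<odot>\<^bsub>M\<^esub> (signed_power k J j \<odot>\<^bsub>M\<^esub> u (J - {j})))"
    unfolding koszul_diff_def using assms finite_subset_idx
    by (intro finsum_smult_ldistr) auto
  also have "\<dots> = (\<Oplus>\<^bsub>M\<^esub>j\<in>J. signed_power k J j \<odot>\<^bsub>M\<^esub> (a \<odot>\<^bsub>M\<^esub> u (J - {j})))"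
  proof (rule M.finsum_cong')
    show "a \<odot>\<^bsub>M\<^esub> (signed_power k J j \<odot>\<^bsub>M\<^esub> u (J - {j})) = signed_power k J j \<odot>\<^bsub>M\<^esub> (a \<odot>\<^bsub>M\<^esub> u (J - {j}))"
      if "j \<in> J" for j
    proof -
      have "signed_power k J j \<in> carrier R" "u (J - {j}) \<in> carrier M"
        using that assms by auto
      then show ?thesis
        using assms(2) by (simp add: smult_assoc1[symmetric] R.m_comm)
    qed
  qed (use assms in auto)
  finally show ?thesis by (simp add: koszul_diff_def)
qed

lemma koszul_diff_zero:
  assumes "J \<subseteq> idx"
  shows "koszul_diff k (\<lambda>_. \<zero>\<^bsub>M\<^esub>) J = \<zero>\<^bsub>M\<^esub>"
  unfolding koszul_diff_def by (rule M.add.finprod_one_eqI) (use assms in auto)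

lemma koszul_diff_square_zero:
  assumes "u \<in> cochains" "J \<subseteq> idx"
  shows "koszul_diff k (koszul_diff k u) J = \<zero>\<^bsub>M\<^esub>"
proof -
  define f where "f j l = signed_power k J j \<odot>\<^bsub>M\<^esub> (signed_power k (J - {j}) l \<odot>\<^bsub>M\<^esub> u (J - {j} - {l}))" for j l
  have f: "f j l = (signed_power k J j \<otimes> signed_power k (J - {j}) l) \<odot>\<^bsub>M\<^esub> u (J - {j} - {l})"
    if "j \<in> J" "l \<in> J" for j l
  proof -
    have "signed_power k J j \<in> carrier R" "signed_power k (J - {j}) l \<in> carrier R"
         "u (J - {j} - {l}) \<in> carrier M"
      using that assms by auto
    then show ?thesis by (simp add: f_def smult_assoc1)
  qed
  have fc: "f j l \<in> carrier M" if "j \<in> J" "l \<in> J" for j l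
    using that assms f by auto
  have "koszul_diff k (koszul_diff k u) J = (\<Oplus>\<^bsub>M\<^esub>j\<in>J. \<Oplus>\<^bsub>M\<^esub>l\<in>J - {j}. f j l)"
    unfolding koszul_diff_def[of k "koszul_diff k u"]
  proof (rule M.finsum_cong')
    show "signed_power k J j \<odot>\<^bsub>M\<^esub> koszul_diff k u (J - {j}) = (\<Oplus>\<^bsub>M\<^esub>l\<in>J - {j}. f j l)"
      if "j \<in> J" for j
      unfolding koszul_diff_def f_def using that assms finite_subset_idx[of "J - {j}"]
      by (intro finsum_smult_ldistr) auto
    show "(\<lambda>j. \<Oplus>\<^bsub>M\<^esub>l\<in>J - {j}. f j l) \<in> J \<rightarrow> carrier M"
      using fc by (auto intro!: M.finsum_closed)
  qed simp
  also have "\<dots> = \<zero>\<^bsub>M\<^esub>"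
  proof (rule M.antisymmetric_finsum_eq_zero)
    show "f j l = \<ominus>\<^bsub>M\<^esub> f l j" if "j \<in> J" "l \<in> J" "j \<noteq> l" for j l
    proof -
      have "J - {j} - {l} = J - {l} - {j}" by auto
      moreover have "signed_power k J l \<otimes> signed_power k (J - {l}) j \<in> carrier R"
          "u (J - {l} - {j}) \<in> carrier M"
        using that assms by auto
      ultimately show ?thesis
        using that assms signed_power_anticommute[OF assms(2) that] f
        by (simp add: smult_l_minus)
    qed
  qed (use fc finite_subset_idx assms in auto)
  finally show ?thesis .
qed

text \<open>
  For the set J that contains I, j and l the signs are those of removing l and j from J in the
  opposite order, so anticommutativity of the signs is the one used for the differential.
\<close>

lemma koszul_codiff_square_zero:
  assumes "u \<in> cochains" "I \<subseteq> idx"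
  shows "koszul_codiff k (koszul_codiff k u) I = \<zero>\<^bsub>M\<^esub>"
proof -
  define f where "f j l = signed_power k I j \<odot>\<^bsub>M\<^esub> (signed_power k (insert j I) l \<odot>\<^bsub>M\<^esub> u (insert l (insert j I)))" for j l
  let ?X = "idx - I"
  have f: "f j l = (signed_power k I j \<otimes> signed_power k (insert j I) l) \<odot>\<^bsub>M\<^esub> u (insert l (insert j I))"
    if "j \<in> ?X" "l \<in> ?X" for j l
  proof -
    have "signed_power k I j \<in> carrier R" "signed_power k (insert j I) l \<in> carrier R"
         "u (insert l (insert j I)) \<in> carrier M"
      using that assms by auto
    then show ?thesis by (simp add: f_def smult_assoc1)
  qed
  have fc: "f j l \<in> carrier M" if "j \<in> ?X" "l \<in> ?X" for j l
    using that assms f by auto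
  have "koszul_codiff k (koszul_codiff k u) I = (\<Oplus>\<^bsub>M\<^esub>j\<in>?X. \<Oplus>\<^bsub>M\<^esub>l\<in>?X - {j}. f j l)"
    unfolding koszul_codiff_def[of k "koszul_codiff k u"]
  proof (rule M.finsum_cong')
    show "signed_power k I j \<odot>\<^bsub>M\<^esub> koszul_codiff k u (insert j I) = (\<Oplus>\<^bsub>M\<^esub>l\<in>?X - {j}. f j l)"
      if "j \<in> ?X" for j
    proof -
      have "idx - insert j I = ?X - {j}" by auto
      then show ?thesis
        unfolding koszul_codiff_def f_def using that assms
        by (auto intro!: finsum_smult_ldistr)
    qed
    show "(\<lambda>j. \<Oplus>\<^bsub>M\<^esub>l\<in>?X - {j}. f j l) \<in> ?X \<rightarrow> carrier M"
      using fc by (auto intro!: M.finsum_closed)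
  qed simp
  also have "\<dots> = \<zero>\<^bsub>M\<^esub>"
  proof (rule M.antisymmetric_finsum_eq_zero)
    show "f j l = \<ominus>\<^bsub>M\<^esub> f l j" if jl: "j \<in> ?X" "l \<in> ?X" "j \<noteq> l" for j l
    proof -
      define J where "J = insert l (insert j I)"
      have J: "J \<subseteq> idx" "j \<in> J" "l \<in> J" "J = insert j (insert l I)" using jl assms by (auto simp: J_def)
      have Jl: "J - {l} = insert j I" "J - {j} = insert l I" using jl by (auto simp: J_def)
      have s: "signed_power k (insert a I) a = signed_power k I a" for a
      proof -
        have "{b \<in> insert a I. b < a} = {b \<in> I. b < a}" by auto
        then show ?thesis by (simp add: signed_power_def)
      qed
      have c: "signed_power k J a \<in> carrier R" "signed_power k I a \<in> carrier R"
        if "a \<in> {j, l}" for a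
        using that jl by auto
      have "signed_power k I j \<otimes> signed_power k (insert j I) l = signed_power k (J - {l}) j \<otimes> signed_power k (J - {l}) l"
        by (simp only: Jl s)
      have sJ: "signed_power k (J - {a}) a = signed_power k J a" for a
      proof -
        have "{b \<in> J - {a}. b < a} = {b \<in> J. b < a}" by auto
        then show ?thesis by (simp add: signed_power_def)
      qed
      have *: "signed_power k I j \<otimes> signed_power k (insert j I) l = signed_power k J l \<otimes> signed_power k (J - {l}) j"
              "signed_power k I l \<otimes> signed_power k (insert l I) j = signed_power k J j \<otimes> signed_power k (J - {j}) l"
        using c Jl s[of j] s[of l] sJ[of j] sJ[of l] R.m_comm by auto
      have "u J \<in> carrier M" "signed_power k J j \<otimes> signed_power k (J - {j}) l \<in> carrier R"
        using J assms jl by auto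
      then show ?thesis
        unfolding f[OF jl(1,2)] f[OF jl(2,1)] * J(4)[symmetric] J_def[symmetric]
        using signed_power_anticommute[OF J(1,3,2)] jl by (simp add: smult_l_minus)
    qed
  qed (use fc in auto)
  finally show ?thesis .
qed

text \<open>
  The transition maps are maps of complexes: y_J is y_j times the product over J without j, and
  the factor y_j^t is what distinguishes the coefficient for k + t from that for k.
\<close>

lemma koszul_diff_yprod_power:
  assumes "u \<in> cochains" "J \<subseteq> idx"
  shows "koszul_diff (k + t) (\<lambda>J. yprod J [^] t \<odot>\<^bsub>M\<^esub> u J) J = yprod J [^] t \<odot>\<^bsub>M\<^esub> koszul_diff k u J"
proof -
  have "yprod J [^] t \<odot>\<^bsub>M\<^esub> koszul_diff k u J
      = (\<Oplus>\<^bsub>M\<^esub>j\<in>J. yprod J [^] t \<odot>\<^bsub>M\<^esub> (signed_power k J j \<odot>\<^bsub>M\<^esub> u (J - {j})))"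
    unfolding koszul_diff_def using assms finite_subset_idx
    by (intro finsum_smult_ldistr) auto
  also have "\<dots> = (\<Oplus>\<^bsub>M\<^esub>j\<in>J. signed_power (k + t) J j \<odot>\<^bsub>M\<^esub> (yprod (J - {j}) [^] t \<odot>\<^bsub>M\<^esub> u (J - {j})))"
  proof (rule M.finsum_cong')
    show "yprod J [^] t \<odot>\<^bsub>M\<^esub> (signed_power k J j \<odot>\<^bsub>M\<^esub> u (J - {j}))
        = signed_power (k + t) J j \<odot>\<^bsub>M\<^esub> (yprod (J - {j}) [^] t \<odot>\<^bsub>M\<^esub> u (J - {j}))"
      if "j \<in> J" for j
    proof -
      have c: "signed_power k J j \<in> carrier R" "u (J - {j}) \<in> carrier M" "j \<in> idx"
           "ys ! j \<in> carrier R" "yprod (J - {j}) \<in> carrier R"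
        using that assms by (auto intro!: yprod_closed)
      then show ?thesis
        using that assms
        by (simp add: yprod_remove[OF assms(2) that] smult_assoc1[symmetric] signed_power_add R.nat_pow_distrib R.m_ac)
    qed
  qed (use assms in \<open>auto intro!: smult_closed R.nat_pow_closed yprod_closed\<close>)
  finally show ?thesis by (simp add: koszul_diff_def)
qed


lemma koszul_diff_finsum:
  assumes "finite X" "\<And>j. j \<in> X \<Longrightarrow> r j \<in> carrier R" "\<And>j. j \<in> X \<Longrightarrow> U j \<in> cochains" "J \<subseteq> idx"
  shows "koszul_diff k (\<lambda>J. \<Oplus>\<^bsub>M\<^esub>j\<in>X. r j \<odot>\<^bsub>M\<^esub> U j J) J = (\<Oplus>\<^bsub>M\<^esub>j\<in>X. r j \<odot>\<^bsub>M\<^esub> koszul_diff k (U j) J)"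
  using assms(1-3)
proof (induction X)
  case empty
  then show ?case using assms(4) by (simp add: koszul_diff_zero)
next
  case (insert x X)
  let ?S = "\<lambda>J. \<Oplus>\<^bsub>M\<^esub>j\<in>X. r j \<odot>\<^bsub>M\<^esub> U j J"
  have S: "?S \<in> cochains" using insert.prems by (auto intro!: cochainsI M.finsum_closed)
  have x: "(\<lambda>J. r x \<odot>\<^bsub>M\<^esub> U x J) \<in> cochains" using insert.prems by (auto intro!: cochainsI)
  have "koszul_diff k (\<lambda>J. \<Oplus>\<^bsub>M\<^esub>j\<in>insert x X. r j \<odot>\<^bsub>M\<^esub> U j J) J
      = koszul_diff k (\<lambda>J. r x \<odot>\<^bsub>M\<^esub> U x J \<oplus>\<^bsub>M\<^esub> ?S J) J"
  proof (rule koszul_diff_cong[OF assms(4)])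
    show "(\<lambda>J. r x \<odot>\<^bsub>M\<^esub> U x J \<oplus>\<^bsub>M\<^esub> ?S J) \<in> cochains"
      using S x by (auto intro!: cochainsI)
    show "(\<Oplus>\<^bsub>M\<^esub>j\<in>insert x X. r j \<odot>\<^bsub>M\<^esub> U j (J - {i})) = r x \<odot>\<^bsub>M\<^esub> U x (J - {i}) \<oplus>\<^bsub>M\<^esub> ?S (J - {i})" for i
      using insert assms(4) by (subst M.finsum_insert) auto
  qed
  also have "\<dots> = r x \<odot>\<^bsub>M\<^esub> koszul_diff k (U x) J \<oplus>\<^bsub>M\<^esub> koszul_diff k ?S J"
    using insert.prems assms(4) S x by (simp add: koszul_diff_add koszul_diff_smult)
  also have "koszul_diff k ?S J = (\<Oplus>\<^bsub>M\<^esub>j\<in>X. r j \<odot>\<^bsub>M\<^esub> koszul_diff k (U j) J)"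
    using insert.prems by (intro insert.IH) auto
  also have "r x \<odot>\<^bsub>M\<^esub> koszul_diff k (U x) J \<oplus>\<^bsub>M\<^esub> \<dots> = (\<Oplus>\<^bsub>M\<^esub>j\<in>insert x X. r j \<odot>\<^bsub>M\<^esub> koszul_diff k (U j) J)"
    using insert assms(4) by (subst M.finsum_insert) auto
  finally show ?case .
qed

lemma koszul_diff_codiff_commute:
  assumes "\<And>I. I \<subseteq> idx \<Longrightarrow> H I \<in> cochains" "I \<subseteq> idx" "J \<subseteq> idx"
  shows "koszul_diff k (\<lambda>J. koszul_codiff l (\<lambda>I. H I J) I) J = koszul_codiff l (\<lambda>I. koszul_diff k (H I) J) I"
  unfolding koszul_codiff_def using assms by (intro koszul_diff_finsum) auto

lemma koszul_codiff_add:
  assumes "u \<in> cochains" "v \<in> cochains" "I \<subseteq> idx"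
  shows "koszul_codiff k (\<lambda>J. u J \<oplus>\<^bsub>M\<^esub> v J) I = koszul_codiff k u I \<oplus>\<^bsub>M\<^esub> koszul_codiff k v I"
proof -
  have "koszul_codiff k (\<lambda>J. u J \<oplus>\<^bsub>M\<^esub> v J) I
      = (\<Oplus>\<^bsub>M\<^esub>j\<in>idx - I. signed_power k I j \<odot>\<^bsub>M\<^esub> u (insert j I) \<oplus>\<^bsub>M\<^esub> signed_power k I j \<odot>\<^bsub>M\<^esub> v (insert j I))"
    unfolding koszul_codiff_def using assms by (intro M.finsum_cong') (auto intro!: smult_r_distr)
  then show ?thesis
    unfolding koszul_codiff_def using assms by (subst M.finsum_addf[symmetric]) auto
qed

lemma koszul_codiff_smult:
  assumes "u \<in> cochains" "a \<in> carrier R" "I \<subseteq> idx"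
  shows "koszul_codiff k (\<lambda>J. a \<odot>\<^bsub>M\<^esub> u J) I = a \<odot>\<^bsub>M\<^esub> koszul_codiff k u I"
proof -
  have "a \<odot>\<^bsub>M\<^esub> koszul_codiff k u I
      = (\<Oplus>\<^bsub>M\<^esub>j\<in>idx - I. a \<odot>\<^bsub>M\<^esub> (signed_power k I j \<odot>\<^bsub>M\<^esub> u (insert j I)))"
    unfolding koszul_codiff_def using assms by (intro finsum_smult_ldistr) auto
  also have "\<dots> = (\<Oplus>\<^bsub>M\<^esub>j\<in>idx - I. signed_power k I j \<odot>\<^bsub>M\<^esub> (a \<odot>\<^bsub>M\<^esub> u (insert j I)))"
  proof (rule M.finsum_cong')
    show "a \<odot>\<^bsub>M\<^esub> (signed_power k I j \<odot>\<^bsub>M\<^esub> u (insert j I)) = signed_power k I j \<odot>\<^bsub>M\<^esub> (a \<odot>\<^bsub>M\<^esub> u (insert j I))"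
      if "j \<in> idx - I" for j
    proof -
      have "signed_power k I j \<in> carrier R" "u (insert j I) \<in> carrier M"
        using that assms by auto
      then show ?thesis
        using assms(2) by (simp add: smult_assoc1[symmetric] R.m_comm)
    qed
  qed (use assms in auto)
  finally show ?thesis by (simp add: koszul_codiff_def)
qed

section \<open>Null homotopies of the diagonal chain map\<close>

text \<open>
  The vector x e_I, as a function of J.  As I varies, these are the values on basis vectors of the
  map from the Koszul complex of y^T over the ring to the Koszul complex of y^T with values in M
  that is induced by the linear map sending 1 to x.
\<close>

definition diagonal :: "'c \<Rightarrow> nat set \<Rightarrow> nat set \<Rightarrow> 'c" where
  "diagonal x I J = (if J = I then x else \<zero>\<^bsub>M\<^esub>)"

lemma diagonal_cochain [simp]: "x \<in> carrier M \<Longrightarrow> diagonal x I \<in> cochains"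
  by (auto intro!: cochainsI simp: diagonal_def)

text \<open>
  Both sides vanish unless J is I with one more index i, and then both are y_i^k x with the same sign.
  In other words, the map sending e_I to x e_I commutes with the differentials.
\<close>

lemma koszul_diff_diagonal:
  assumes x: "x \<in> carrier M" and I: "I \<subseteq> idx" and J: "J \<subseteq> idx"
  shows "koszul_diff k (diagonal x I) J = koszul_codiff k (\<lambda>I. diagonal x I J) I"
proof (cases "\<exists>i\<in>J. J - {i} = I")
  case True
  then obtain i where i: "i \<in> J" "J - {i} = I" by blast
  then have i': "i \<in> idx - I" "insert i I = J" using J by auto
  have "{l \<in> J. l < i} = {l \<in> I. l < i}" using i by auto
  then have s: "signed_power k I i = signed_power k J i" by (simp add: signed_power_def)
  have c: "signed_power k J j \<in> carrier R" "signed_power k I j \<in> carrier R" if "j \<in> idx" for j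
    using that by auto
  have "koszul_diff k (diagonal x I) J = (\<Oplus>\<^bsub>M\<^esub>j\<in>J. if i = j then signed_power k J j \<odot>\<^bsub>M\<^esub> x else \<zero>\<^bsub>M\<^esub>)"
    unfolding koszul_diff_def
  proof (rule M.finsum_cong')
    show "signed_power k J j \<odot>\<^bsub>M\<^esub> diagonal x I (J - {j}) = (if i = j then signed_power k J j \<odot>\<^bsub>M\<^esub> x else \<zero>\<^bsub>M\<^esub>)"
      if "j \<in> J" for j
    proof -
      have "J - {j} = I \<longleftrightarrow> i = j" using that i by auto
      then show ?thesis using that J by (auto simp: diagonal_def)
    qed
  qed (use x J in auto)
  also have "\<dots> = signed_power k J i \<odot>\<^bsub>M\<^esub> x"
    using i J x finite_subset_idx by (intro M.finsum_singleton) auto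
  finally have 1: "koszul_diff k (diagonal x I) J = signed_power k J i \<odot>\<^bsub>M\<^esub> x" .
  have "koszul_codiff k (\<lambda>I. diagonal x I J) I
      = (\<Oplus>\<^bsub>M\<^esub>j\<in>idx - I. if i = j then signed_power k I j \<odot>\<^bsub>M\<^esub> x else \<zero>\<^bsub>M\<^esub>)"
    unfolding koszul_codiff_def
  proof (rule M.finsum_cong')
    show "signed_power k I j \<odot>\<^bsub>M\<^esub> diagonal x (insert j I) J = (if i = j then signed_power k I j \<odot>\<^bsub>M\<^esub> x else \<zero>\<^bsub>M\<^esub>)"
      if "j \<in> idx - I" for j
    proof -
      have "J = insert j I \<longleftrightarrow> i = j" using that i' by auto
      then show ?thesis using that by (auto simp: diagonal_def)
    qed
  qed (use x in auto)
  also have "\<dots> = signed_power k I i \<odot>\<^bsub>M\<^esub> x"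
    using i' x by (intro M.finsum_singleton) auto
  finally show ?thesis using 1 s by simp
next
  case False
  have "koszul_diff k (diagonal x I) J = \<zero>\<^bsub>M\<^esub>"
    unfolding koszul_diff_def using False J
    by (intro M.add.finprod_one_eqI) (auto simp: diagonal_def)
  moreover have "koszul_codiff k (\<lambda>I. diagonal x I J) I = \<zero>\<^bsub>M\<^esub>"
    unfolding koszul_codiff_def
  proof (rule M.add.finprod_one_eqI)
    fix j assume j: "j \<in> idx - I"
    then have "J \<noteq> insert j I" using False by (metis DiffD2 Diff_insert_absorb insertI1)
    then show "signed_power k I j \<odot>\<^bsub>M\<^esub> diagonal x (insert j I) J = \<zero>\<^bsub>M\<^esub>"
      using j by (auto simp: diagonal_def)
  qed
  ultimately show ?thesis by simp
qed

lemma koszul_primitive_raise: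
  assumes "u \<in> cochains" "v \<in> cochains" "t \<le> t'" "J \<subseteq> idx"
    and "yprod J [^] t \<odot>\<^bsub>M\<^esub> u J = koszul_diff (k + t) v J"
  shows "yprod J [^] t' \<odot>\<^bsub>M\<^esub> u J = koszul_diff (k + t') (\<lambda>J. yprod J [^] (t' - t) \<odot>\<^bsub>M\<^esub> v J) J"
proof -
  have "k + t' = (k + t) + (t' - t)" using assms(3) by simp
  then have "koszul_diff (k + t') (\<lambda>J. yprod J [^] (t' - t) \<odot>\<^bsub>M\<^esub> v J) J
      = yprod J [^] (t' - t) \<odot>\<^bsub>M\<^esub> (yprod J [^] t \<odot>\<^bsub>M\<^esub> u J)"
    using koszul_diff_yprod_power[OF assms(2,4), of "k + t" "t' - t"] assms(5) by simp
  also have "\<dots> = (yprod J [^] (t' - t) \<otimes> yprod J [^] t) \<odot>\<^bsub>M\<^esub> u J"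
    using assms(1,4) by (simp add: smult_assoc1)
  also have "yprod J [^] (t' - t) \<otimes> yprod J [^] t = yprod J [^] t'"
    using assms(3,4) by (simp add: R.nat_pow_mult)
  finally show ?thesis by simp
qed

lemma koszul_exactD:
  assumes "koszul_exact i" "u \<in> cochains" "\<forall>J\<in>deg (Suc i). koszul_diff k u J = \<zero>\<^bsub>M\<^esub>"
  shows "\<exists>t. \<exists>v\<in>cochains. \<forall>J\<in>deg i. yprod J [^] t \<odot>\<^bsub>M\<^esub> u J = koszul_diff (k + t) v J"
  using assms unfolding koszul_exact_def by simp

text \<open>
  Finitely many cocycles can be killed at one common stage, since a primitive at one stage gives
  a primitive at every later one.
\<close>

lemma koszul_exact_family:
  assumes "koszul_exact i" "finite X" "\<forall>a\<in>X. U a \<in> cochains"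
    and "\<forall>a\<in>X. \<forall>J\<in>deg (Suc i). koszul_diff k (U a) J = \<zero>\<^bsub>M\<^esub>"
  shows "\<exists>t V. (\<forall>a\<in>X. V a \<in> cochains) \<and>
    (\<forall>a\<in>X. \<forall>J\<in>deg i. yprod J [^] t \<odot>\<^bsub>M\<^esub> U a J = koszul_diff (k + t) (V a) J)"
proof -
  have "\<forall>a\<in>X. \<exists>t. \<exists>v\<in>cochains. \<forall>J\<in>deg i. yprod J [^] t \<odot>\<^bsub>M\<^esub> U a J = koszul_diff (k + t) v J"
    using assms(1,3,4) by (auto intro: koszul_exactD)
  then obtain tt V where V: "\<And>a. a \<in> X \<Longrightarrow> V a \<in> cochains"
    and tt: "\<And>a J. a \<in> X \<Longrightarrow> J \<in> deg i \<Longrightarrow> yprod J [^] tt a \<odot>\<^bsub>M\<^esub> U a J = koszul_diff (k + tt a) (V a) J"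
    by metis
  define t where "t = (\<Sum>a\<in>X. tt a)"
  have le: "tt a \<le> t" if "a \<in> X" for a
    unfolding t_def using that assms(2) by (intro member_le_sum) auto
  let ?V = "\<lambda>a J. yprod J [^] (t - tt a) \<odot>\<^bsub>M\<^esub> V a J"
  have "?V a \<in> cochains" if "a \<in> X" for a
    using V[OF that] by (auto intro!: cochainsI)
  moreover have "yprod J [^] t \<odot>\<^bsub>M\<^esub> U a J = koszul_diff (k + t) (?V a) J"
    if "a \<in> X" "J \<in> deg i" for a J
    using that V assms(3) le tt by (intro koszul_primitive_raise) (auto simp: deg_iff)
  ultimately show ?thesis
    by (intro exI[of _ t] exI[of _ ?V]) simp
qed

text \<open>
  A homotopy to zero, valid on the basis vectors e_I with at least c indices, of the chain map
  e_I \<open>\<mapsto>\<close> x e_I followed by the transition map to the stage T + s.  The cochain h I is the value of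
  the homotopy on e_I; it matters only in degree card I - 1, which for empty I is
  no degree at all: the differential of any cochain vanishes at the empty set.
\<close>

definition partial_homotopy :: "nat \<Rightarrow> 'c \<Rightarrow> nat \<Rightarrow> bool" where
  "partial_homotopy T x c \<longleftrightarrow>
     (\<exists>s h. (\<forall>I. I \<subseteq> idx \<longrightarrow> h I \<in> cochains) \<and>
        (\<forall>I. I \<subseteq> idx \<longrightarrow> c \<le> card I \<longrightarrow> (\<forall>J\<in>deg (card I).
            yprod J [^] s \<odot>\<^bsub>M\<^esub> diagonal x I J
          = koszul_diff (T + s) (h I) J \<oplus>\<^bsub>M\<^esub> koszul_codiff T (\<lambda>I. h I J) I)))"

lemma partial_homotopy_start:
  assumes "length ys < c"
  shows "partial_homotopy T x c"
proof -
  have le: "card I \<le> length ys" if "I \<subseteq> idx" for I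
    using that card_mono[OF finite_idx that] by (simp add: idx_def)
  have "\<not> c \<le> card I" if "I \<subseteq> idx" for I
    using le[OF that] assms by simp
  moreover have "(\<lambda>_. \<zero>\<^bsub>M\<^esub>) \<in> cochains" by (auto intro!: cochainsI)
  ultimately show ?thesis
    unfolding partial_homotopy_def
    by (intro exI[of _ 0] exI[of _ "\<lambda>_ _. \<zero>\<^bsub>M\<^esub>"]) simp
qed

text \<open>
  The usual inductive construction of a homotopy into an exact complex.  What the homotopy already
  defined on degree c + 1 leaves of the chain map in degree c is a cocycle, because the chain
  map commutes with the differentials and the square of the differential is zero.  A primitive of
  it, available at a later stage, is the value of the homotopy in degree c.
\<close>

lemma partial_homotopy_step:
  assumes x: "x \<in> carrier M" and exact: "koszul_exact c" and ph: "partial_homotopy T x (Suc c)"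
  shows "partial_homotopy T x c"
proof -
  obtain s h where 1: "\<forall>I. I \<subseteq> idx \<longrightarrow> h I \<in> cochains"
    and 2: "\<forall>I. I \<subseteq> idx \<longrightarrow> Suc c \<le> card I \<longrightarrow> (\<forall>J\<in>deg (card I).
            yprod J [^] s \<odot>\<^bsub>M\<^esub> diagonal x I J
          = koszul_diff (T + s) (h I) J \<oplus>\<^bsub>M\<^esub> koszul_codiff T (\<lambda>I. h I J) I)"
    using ph unfolding partial_homotopy_def by (elim exE conjE) (rule that)
  note h = 1[rule_format] and eq = 2[rule_format]
  have hJ: "(\<lambda>I. h I J) \<in> cochains" if "J \<subseteq> idx" for J
    using h that by (auto intro!: cochainsI)
  define w where "w I J = koszul_codiff T (\<lambda>I. h I J) I" for I J
  have w: "w I \<in> cochains" if "I \<subseteq> idx" for I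
    unfolding w_def using that hJ by (auto intro!: cochainsI)
  \<comment> \<open>the defect of the homotopy in degree c\<close>
  define g where "g I J = yprod J [^] s \<odot>\<^bsub>M\<^esub> diagonal x I J \<oplus>\<^bsub>M\<^esub> (\<ominus> \<one>) \<odot>\<^bsub>M\<^esub> w I J" for I J
  have yd: "(\<lambda>J. yprod J [^] s \<odot>\<^bsub>M\<^esub> diagonal x I J) \<in> cochains" for I
    using x by (auto intro!: cochainsI simp: diagonal_def)
  have g: "g I \<in> cochains" if "I \<subseteq> idx" for I
    unfolding g_def using w[OF that] yd[of I] by (auto intro!: cochainsI)
  have cocycle: "koszul_diff (T + s) (g I) J = \<zero>\<^bsub>M\<^esub>"
    if I: "I \<subseteq> idx" "card I = c" and J: "J \<in> deg (Suc c)" for I J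
  proof -
    have J': "J \<subseteq> idx" "card J = Suc c" using J by (auto simp: deg_iff)
    have mw: "(\<lambda>J. (\<ominus> \<one>) \<odot>\<^bsub>M\<^esub> w I J) \<in> cochains"
      using w I by (auto intro!: cochainsI)
    have D: "(\<lambda>I. koszul_diff (T + s) (h I) J) \<in> cochains"
      using h J' by (auto intro!: cochainsI)
    have W: "(\<lambda>I. w I J) \<in> cochains"
      using w J' by (auto intro!: cochainsI)
    have dJ: "(\<lambda>I. diagonal x I J) \<in> cochains"
      using x by (auto intro!: cochainsI simp: diagonal_def)
    have "koszul_diff (T + s) (g I) J
        = koszul_diff (T + s) (\<lambda>J. yprod J [^] s \<odot>\<^bsub>M\<^esub> diagonal x I J) J
          \<oplus>\<^bsub>M\<^esub> koszul_diff (T + s) (\<lambda>J. (\<ominus> \<one>) \<odot>\<^bsub>M\<^esub> w I J) J"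
      unfolding g_def using yd mw J' by (intro koszul_diff_add) auto
    also have "koszul_diff (T + s) (\<lambda>J. yprod J [^] s \<odot>\<^bsub>M\<^esub> diagonal x I J) J
        = koszul_codiff T (\<lambda>I. yprod J [^] s \<odot>\<^bsub>M\<^esub> diagonal x I J) I"
      using x I J' dJ
      by (simp add: koszul_diff_yprod_power koszul_diff_diagonal koszul_codiff_smult)
    also have "\<dots> = koszul_codiff T (\<lambda>I. koszul_diff (T + s) (h I) J \<oplus>\<^bsub>M\<^esub> w I J) I"
    proof (rule koszul_codiff_cong)
      show "(\<lambda>I. koszul_diff (T + s) (h I) J \<oplus>\<^bsub>M\<^esub> w I J) \<in> cochains"
        using D W by (auto intro!: cochainsI)
      show "yprod J [^] s \<odot>\<^bsub>M\<^esub> diagonal x (insert j I) J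
          = koszul_diff (T + s) (h (insert j I)) J \<oplus>\<^bsub>M\<^esub> w (insert j I) J" if "j \<in> idx - I" for j
      proof -
        have "card (insert j I) = Suc c" "insert j I \<subseteq> idx"
          using that I finite_subset_idx[of I] by auto
        then show ?thesis unfolding w_def using J by (intro eq) auto
      qed
    qed (use I in auto)
    also have "\<dots> = koszul_codiff T (\<lambda>I. koszul_diff (T + s) (h I) J) I \<oplus>\<^bsub>M\<^esub> koszul_codiff T (\<lambda>I. w I J) I"
      using D W I by (intro koszul_codiff_add) auto
    also have "koszul_codiff T (\<lambda>I. w I J) I = \<zero>\<^bsub>M\<^esub>"
      unfolding w_def using hJ J' I by (intro koszul_codiff_square_zero) auto
    also have "koszul_codiff T (\<lambda>I. koszul_diff (T + s) (h I) J) I = koszul_diff (T + s) (w I) J"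
      unfolding w_def using h I J' by (intro koszul_diff_codiff_commute[symmetric]) auto
    also have "koszul_diff (T + s) (\<lambda>J. (\<ominus> \<one>) \<odot>\<^bsub>M\<^esub> w I J) J = \<ominus>\<^bsub>M\<^esub> koszul_diff (T + s) (w I) J"
      using w I J' by (simp add: koszul_diff_smult smult_l_minus)
    finally show ?thesis
      using w I J' by (simp add: M.r_neg)
  qed
  have g_deg: "\<forall>I\<in>deg c. g I \<in> cochains"
    using g by (simp add: deg_iff)
  have cocycle_deg: "\<forall>I\<in>deg c. \<forall>J\<in>deg (Suc c). koszul_diff (T + s) (g I) J = \<zero>\<^bsub>M\<^esub>"
    using cocycle by (simp add: deg_iff)
  obtain t V where V_Ball: "\<forall>I\<in>deg c. V I \<in> cochains"
    and Veq_Ball: "\<forall>I\<in>deg c. \<forall>J\<in>deg c. yprod J [^] t \<odot>\<^bsub>M\<^esub> g I J = koszul_diff (T + s + t) (V I) J"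
    using koszul_exact_family[OF exact finite_deg g_deg cocycle_deg]
    by (elim exE conjE) (rule that)
  note V = V_Ball[rule_format] and Veq = Veq_Ball[rule_format]
  \<comment> \<open>the old homotopy is pushed to the later stage at which the primitives V live\<close>
  define h' where "h' I J = (if card I = c then V I J else yprod J [^] t \<odot>\<^bsub>M\<^esub> h I J)" for I J
  have h': "h' I \<in> cochains" if "I \<subseteq> idx" for I
    using that h V unfolding h'_def by (auto intro!: cochainsI simp: deg_iff)
  have codiff_h': "koszul_codiff T (\<lambda>I. h' I J) I = yprod J [^] t \<odot>\<^bsub>M\<^esub> w I J"
    if I: "I \<subseteq> idx" "c \<le> card I" and J: "J \<subseteq> idx" for I J
  proof -
    have "koszul_codiff T (\<lambda>I. h' I J) I = koszul_codiff T (\<lambda>I. yprod J [^] t \<odot>\<^bsub>M\<^esub> h I J) I"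
    proof (rule koszul_codiff_cong)
      show "h' (insert j I) J = yprod J [^] t \<odot>\<^bsub>M\<^esub> h (insert j I) J" if "j \<in> idx - I" for j
      proof -
        have "card (insert j I) = Suc (card I)"
          using that I finite_subset_idx[of I] by auto
        then show ?thesis using I by (simp add: h'_def)
      qed
      show "(\<lambda>I. yprod J [^] t \<odot>\<^bsub>M\<^esub> h I J) \<in> cochains"
      proof (rule cochainsI)
        fix K assume "K \<subseteq> idx"
        with J have "h K J \<in> carrier M" by (intro cochainsD[OF h])
        then show "yprod J [^] t \<odot>\<^bsub>M\<^esub> h K J \<in> carrier M" using J by simp
      qed
    qed (fact I(1))
    also have "\<dots> = yprod J [^] t \<odot>\<^bsub>M\<^esub> w I J"
      unfolding w_def using hJ I J by (intro koszul_codiff_smult) auto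
    finally show ?thesis .
  qed
  have "yprod J [^] (s + t) \<odot>\<^bsub>M\<^esub> diagonal x I J
      = koszul_diff (T + (s + t)) (h' I) J \<oplus>\<^bsub>M\<^esub> koszul_codiff T (\<lambda>I. h' I J) I"
    if I: "I \<subseteq> idx" "c \<le> card I" and J: "J \<in> deg (card I)" for I J
  proof -
    have J': "J \<subseteq> idx" "card J = card I" using J by (auto simp: deg_iff)
    have c: "w I J \<in> carrier M" "yprod J [^] s \<odot>\<^bsub>M\<^esub> diagonal x I J \<in> carrier M"
        "yprod J [^] t \<in> carrier R" "diagonal x I J \<in> carrier M"
      using w I J' x by (auto simp: diagonal_def)
    have split: "yprod J [^] (s + t) \<odot>\<^bsub>M\<^esub> diagonal x I J = yprod J [^] t \<odot>\<^bsub>M\<^esub> (yprod J [^] s \<odot>\<^bsub>M\<^esub> diagonal x I J)"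
      using J' c by (simp add: smult_assoc1[symmetric] R.nat_pow_mult add.commute)
    show ?thesis
    proof (cases "card I = c")
      case True
      then have deg: "I \<in> deg c" "J \<in> deg c" using I J by (auto simp: deg_iff)
      have gg: "g I J \<in> carrier M" using g I J' by auto
      have "yprod J [^] s \<odot>\<^bsub>M\<^esub> diagonal x I J = g I J \<oplus>\<^bsub>M\<^esub> w I J"
        unfolding g_def using c by (simp add: smult_l_minus M.a_assoc M.l_neg)
      then have "yprod J [^] (s + t) \<odot>\<^bsub>M\<^esub> diagonal x I J
          = yprod J [^] t \<odot>\<^bsub>M\<^esub> g I J \<oplus>\<^bsub>M\<^esub> yprod J [^] t \<odot>\<^bsub>M\<^esub> w I J"
        using split c gg by (simp add: smult_r_distr)
      also have "yprod J [^] t \<odot>\<^bsub>M\<^esub> g I J = koszul_diff (T + (s + t)) (V I) J"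
        using Veq[OF deg] by (simp add: add.assoc)
      also have "V I = h' I" using True by (auto simp: h'_def)
      finally show ?thesis using codiff_h' I J' by simp
    next
      case False
      then have ci: "Suc c \<le> card I" using I by simp
      have "yprod J [^] (s + t) \<odot>\<^bsub>M\<^esub> diagonal x I J
          = yprod J [^] t \<odot>\<^bsub>M\<^esub> (koszul_diff (T + s) (h I) J \<oplus>\<^bsub>M\<^esub> w I J)"
        unfolding split w_def using eq[OF I(1) ci J] by simp
      also have "\<dots> = yprod J [^] t \<odot>\<^bsub>M\<^esub> koszul_diff (T + s) (h I) J \<oplus>\<^bsub>M\<^esub> yprod J [^] t \<odot>\<^bsub>M\<^esub> w I J"
        using c h I J' by (intro smult_r_distr) auto
      also have "yprod J [^] t \<odot>\<^bsub>M\<^esub> koszul_diff (T + s) (h I) J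
          = koszul_diff (T + s + t) (\<lambda>J. yprod J [^] t \<odot>\<^bsub>M\<^esub> h I J) J"
        using h I J' by (intro koszul_diff_yprod_power[symmetric]) auto
      also have "(\<lambda>J. yprod J [^] t \<odot>\<^bsub>M\<^esub> h I J) = h' I" using False by (auto simp: h'_def)
      finally show ?thesis using codiff_h' I J' by (simp add: add.assoc)
    qed
  qed
  then show ?thesis
    unfolding partial_homotopy_def using h'
    by (intro exI[of _ "s + t"] exI[of _ h']) auto
qed

lemma partial_homotopy_descend:
  assumes "x \<in> carrier M" "\<And>i. c \<le> i \<Longrightarrow> i < c' \<Longrightarrow> koszul_exact i" "c \<le> c'" "partial_homotopy T x c'"
  shows "partial_homotopy T x c"
  using assms(3,2,4)
proof (induction rule: dec_induct)
  case base
  then show ?case by simp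
next
  case (step i)
  have "koszul_exact i" using step.prems(1)[of i] step.hyps by simp
  with assms(1) have ph: "partial_homotopy T x i"
    using step.prems(2) by (rule partial_homotopy_step)
  show ?case
  proof (rule step.IH[OF _ ph])
    show "koszul_exact j" if "c \<le> j" "j < i" for j using step.prems(1)[of j] that by simp
  qed
qed

text \<open>
  Evaluate the homotopy formula on the basis vector of the empty set, at the empty set: the product
  over the empty set is 1, the differential contributes nothing, and the remaining term is a
  combination of the y_j^T.
\<close>

lemma partial_homotopy_zero_imp_power_combination:
  assumes x: "x \<in> carrier M" and "partial_homotopy T x 0"
  obtains v where "v \<in> idx \<rightarrow> carrier M" "x = (\<Oplus>\<^bsub>M\<^esub>j\<in>idx. (ys ! j) [^] T \<odot>\<^bsub>M\<^esub> v j)"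
proof -
  obtain s h where 1: "\<forall>I. I \<subseteq> idx \<longrightarrow> h I \<in> cochains"
    and 2: "\<forall>I. I \<subseteq> idx \<longrightarrow> 0 \<le> card I \<longrightarrow> (\<forall>J\<in>deg (card I).
            yprod J [^] s \<odot>\<^bsub>M\<^esub> diagonal x I J
          = koszul_diff (T + s) (h I) J \<oplus>\<^bsub>M\<^esub> koszul_codiff T (\<lambda>I. h I J) I)"
    using assms(2) unfolding partial_homotopy_def by (elim exE conjE) (rule that)
  note h = 1[rule_format] and eq = 2[rule_format]
  have "{} \<in> deg (card {})" by (simp add: deg_iff)
  moreover have "(\<lambda>I. h I {}) \<in> cochains" using h by (auto intro!: cochainsI)
  ultimately have "x = koszul_codiff T (\<lambda>I. h I {}) {}"
    using x eq[of "{}" "{}"] by (simp add: diagonal_def koszul_diff_def cech_prod_def)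
  also have "\<dots> = (\<Oplus>\<^bsub>M\<^esub>j\<in>idx. (ys ! j) [^] T \<odot>\<^bsub>M\<^esub> h {j} {})"
    by (simp add: koszul_codiff_def signed_power_def)
  finally show thesis
    using h by (intro that[of "\<lambda>j. h {j} {}"]) auto
qed

end


section \<open>Homomorphisms, the vanishing gap and extensions\<close>

locale module_sequence_hom =
  N: module_sequence R N ys + P: module_sequence R P ys
  for R (structure) and N (structure) and P (structure) and ys +
  fixes \<phi>
  assumes hom_closed [simp, intro]: "x \<in> carrier N \<Longrightarrow> \<phi> x \<in> carrier P"
    and hom_add: "x \<in> carrier N \<Longrightarrow> y \<in> carrier N \<Longrightarrow> \<phi> (x \<oplus>\<^bsub>N\<^esub> y) = \<phi> x \<oplus>\<^bsub>P\<^esub> \<phi> y"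
    and hom_smult: "a \<in> carrier R \<Longrightarrow> x \<in> carrier N \<Longrightarrow> \<phi> (a \<odot>\<^bsub>N\<^esub> x) = a \<odot>\<^bsub>P\<^esub> \<phi> x"
begin

lemma hom_finsum:
  "finite X \<Longrightarrow> f \<in> X \<rightarrow> carrier N \<Longrightarrow> \<phi> (\<Oplus>\<^bsub>N\<^esub>j\<in>X. f j) = (\<Oplus>\<^bsub>P\<^esub>j\<in>X. \<phi> (f j))"
  by (rule finsum_hom) (auto simp: hom_add intro: N.M.abelian_group_axioms P.M.abelian_group_axioms)

lemma hom_zero: "\<phi> \<zero>\<^bsub>N\<^esub> = \<zero>\<^bsub>P\<^esub>"
  using hom_finsum[of "{}"] by simp

lemma hom_cochain: "u \<in> N.cochains \<Longrightarrow> (\<lambda>J. \<phi> (u J)) \<in> P.cochains"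
  by (auto intro!: P.cochainsI)

lemma hom_koszul_diff:
  assumes "u \<in> N.cochains" "J \<subseteq> N.idx"
  shows "\<phi> (N.koszul_diff k u J) = P.koszul_diff k (\<lambda>J. \<phi> (u J)) J"
proof -
  have "\<phi> (N.koszul_diff k u J) = (\<Oplus>\<^bsub>P\<^esub>j\<in>J. \<phi> (N.signed_power k J j \<odot>\<^bsub>N\<^esub> u (J - {j})))"
    unfolding N.koszul_diff_def using assms N.finite_subset_idx by (intro hom_finsum) auto
  also have "\<dots> = P.koszul_diff k (\<lambda>J. \<phi> (u J)) J"
    unfolding P.koszul_diff_def using assms by (intro P.M.finsum_cong') (auto intro!: hom_smult)
  finally show ?thesis .
qed

lemma hom_koszul_codiff:
  assumes "u \<in> N.cochains" "I \<subseteq> N.idx"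
  shows "\<phi> (N.koszul_codiff k u I) = P.koszul_codiff k (\<lambda>J. \<phi> (u J)) I"
proof -
  have "\<phi> (N.koszul_codiff k u I) = (\<Oplus>\<^bsub>P\<^esub>j\<in>N.idx - I. \<phi> (N.signed_power k I j \<odot>\<^bsub>N\<^esub> u (insert j I)))"
    unfolding N.koszul_codiff_def using assms by (intro hom_finsum) auto
  also have "\<dots> = P.koszul_codiff k (\<lambda>J. \<phi> (u J)) I"
    unfolding P.koszul_codiff_def using assms by (intro P.M.finsum_cong') (auto intro!: hom_smult)
  finally show ?thesis .
qed

lemma hom_partial_homotopy:
  assumes x: "x \<in> carrier N" and ph: "N.partial_homotopy T x c"
  shows "P.partial_homotopy T (\<phi> x) c"
proof -
  obtain s h where 1: "\<forall>I. I \<subseteq> N.idx \<longrightarrow> h I \<in> N.cochains"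
    and 2: "\<forall>I. I \<subseteq> N.idx \<longrightarrow> c \<le> card I \<longrightarrow> (\<forall>J\<in>N.deg (card I).
            N.yprod J [^] s \<odot>\<^bsub>N\<^esub> N.diagonal x I J
          = N.koszul_diff (T + s) (h I) J \<oplus>\<^bsub>N\<^esub> N.koszul_codiff T (\<lambda>I. h I J) I)"
    using ph unfolding N.partial_homotopy_def by (elim exE conjE) (rule that)
  note h = 1[rule_format] and eq = 2[rule_format]
  have "N.yprod J [^] s \<odot>\<^bsub>P\<^esub> P.diagonal (\<phi> x) I J
          = P.koszul_diff (T + s) (\<lambda>J. \<phi> (h I J)) J \<oplus>\<^bsub>P\<^esub> P.koszul_codiff T (\<lambda>I. \<phi> (h I J)) I"
    if I: "I \<subseteq> N.idx" "c \<le> card I" and J: "J \<in> N.deg (card I)" for I J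
  proof -
    have J': "J \<subseteq> N.idx" using J by (auto simp: N.deg_iff)
    have hJ: "(\<lambda>I. h I J) \<in> N.cochains" using h J' by (auto intro!: N.cochainsI)
    have "P.diagonal (\<phi> x) I J = \<phi> (N.diagonal x I J)"
      by (simp add: P.diagonal_def N.diagonal_def hom_zero)
    moreover have "N.diagonal x I J \<in> carrier N" using x by (simp add: N.diagonal_def)
    ultimately have "N.yprod J [^] s \<odot>\<^bsub>P\<^esub> P.diagonal (\<phi> x) I J = \<phi> (N.yprod J [^] s \<odot>\<^bsub>N\<^esub> N.diagonal x I J)"
      using J' by (simp add: hom_smult)
    then show ?thesis
      unfolding eq[OF I J] using h[OF I(1)] hJ I J'
      by (simp add: hom_add hom_koszul_diff hom_koszul_codiff)
  qed
  then show ?thesis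
    unfolding P.partial_homotopy_def using h by (intro exI[of _ s] exI[of _ "\<lambda>I J. \<phi> (h I J)"]) (auto intro: hom_cochain)
qed

text \<open>
  The homotopy is constructed in N down to degree c, transported along \<open>\<phi>\<close>, and continued in P down
  to degree 0.  It starts in the degrees beyond the length of the sequence, where there is nothing
  to do.
\<close>

theorem hom_image_in_power_submodule:
  fixes T :: nat
  assumes "\<And>i. c \<le> i \<Longrightarrow> N.koszul_exact i" and "\<And>i. i < c \<Longrightarrow> P.koszul_exact i" and x: "x \<in> carrier N"
  obtains v where "v \<in> N.idx \<rightarrow> carrier P" "\<phi> x = (\<Oplus>\<^bsub>P\<^esub>j\<in>N.idx. (ys ! j) [^] T \<odot>\<^bsub>P\<^esub> v j)"
proof -
  have "N.partial_homotopy T x c"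
  proof (cases "c \<le> Suc (length ys)")
    case True
    then show ?thesis
      using assms(1) by (intro N.partial_homotopy_descend[OF x _ True N.partial_homotopy_start]) auto
  next
    case False
    then show ?thesis
      by (intro N.partial_homotopy_start) simp
  qed
  then have "P.partial_homotopy T (\<phi> x) c"
    by (rule hom_partial_homotopy[OF x])
  then have "P.partial_homotopy T (\<phi> x) 0"
    using assms x by (intro P.partial_homotopy_descend[of _ 0 c]) auto
  then show thesis
    using P.partial_homotopy_zero_imp_power_combination[of "\<phi> x" T] x that by blast
qed

text \<open>
  A cocycle of N is corrected by the differential of a lift of a primitive of its image in P; what
  remains comes from a cocycle of K, which has a primitive too.  This is exactness at N of the long
  exact cohomology sequence of \<open>0 \<rightarrow> K \<rightarrow> N \<rightarrow> P \<rightarrow> 0\<close>, for vanishing outer terms.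
\<close>

lemma koszul_exact_extension:
  assumes surj: "\<And>z. z \<in> carrier P \<Longrightarrow> \<exists>x\<in>carrier N. \<phi> x = z"
    and K: "module_sequence_hom R K N ys \<iota>" and inj: "inj_on \<iota> (carrier K)"
    and ker: "\<And>x. x \<in> carrier N \<Longrightarrow> \<phi> x = \<zero>\<^bsub>P\<^esub> \<Longrightarrow> x \<in> \<iota> ` carrier K"
    and exK: "module_sequence.koszul_exact R K ys i" and exP: "P.koszul_exact i"
  shows "N.koszul_exact i"
  unfolding N.koszul_exact_def
proof (intro allI ballI impI)
  interpret K: module_sequence_hom R K N ys \<iota> by fact
  fix k u assume u: "u \<in> N.cochains" and du: "\<forall>J\<in>N.deg (Suc i). N.koszul_diff k u J = \<zero>\<^bsub>N\<^esub>"
  have cocycle: "\<forall>J\<in>N.deg (Suc i). P.koszul_diff k (\<lambda>J. \<phi> (u J)) J = \<zero>\<^bsub>P\<^esub>"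
    using du hom_koszul_diff[OF u, where k = k, symmetric] by (simp add: N.deg_iff hom_zero)
  obtain t v' where v': "v' \<in> P.cochains"
    and v'_Ball: "\<forall>J\<in>N.deg i. N.yprod J [^] t \<odot>\<^bsub>P\<^esub> \<phi> (u J) = P.koszul_diff (k + t) v' J"
    using P.koszul_exactD[OF exP hom_cochain[OF u] cocycle] by (elim exE bexE) (rule that)
  note v'eq = v'_Ball[rule_format]
  have "\<forall>J. \<exists>x. J \<subseteq> N.idx \<longrightarrow> x \<in> carrier N \<and> \<phi> x = v' J"
    using surj P.cochainsD[OF v'] by blast
  then obtain v where v0: "\<And>J. J \<subseteq> N.idx \<Longrightarrow> v J \<in> carrier N \<and> \<phi> (v J) = v' J"
    by metis
  then have v: "v \<in> N.cochains" by (auto intro!: N.cochainsI)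
  \<comment> \<open>the corrected cocycle, which comes from K in degree i\<close>
  define a where "a J = N.yprod J [^] t \<odot>\<^bsub>N\<^esub> u J \<oplus>\<^bsub>N\<^esub> (\<ominus> \<one>) \<odot>\<^bsub>N\<^esub> N.koszul_diff (k + t) v J" for J
  have yu: "(\<lambda>J. N.yprod J [^] t \<odot>\<^bsub>N\<^esub> u J) \<in> N.cochains"
    using u by (auto intro!: N.cochainsI)
  have dv: "N.koszul_diff (k + t) v \<in> N.cochains"
    using v by (auto intro!: N.cochainsI)
  have a: "a \<in> N.cochains"
    unfolding a_def using yu dv by (auto intro!: N.cochainsI)
  have "\<phi> (a J) = \<zero>\<^bsub>P\<^esub>" if J: "J \<in> N.deg i" for J
  proof -
    have J': "J \<subseteq> N.idx" using J by (simp add: N.deg_iff)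
    have "\<phi> (N.koszul_diff (k + t) v J) = P.koszul_diff (k + t) v' J"
      using v v0 v' J' hom_koszul_diff[OF v J'] P.koszul_diff_cong[OF J' v', of "\<lambda>J. \<phi> (v J)" "k + t"] by auto
    then show ?thesis
      unfolding a_def using u dv J' v' v'eq[OF J]
      by (simp add: hom_add hom_smult P.smult_l_minus P.M.r_neg)
  qed
  then have "\<forall>J. \<exists>b. J \<in> N.deg i \<longrightarrow> b \<in> carrier K \<and> \<iota> b = a J"
    using a ker by (auto simp: N.deg_iff) (metis N.cochainsD imageE)
  then obtain b0 where b0: "\<And>J. J \<in> N.deg i \<Longrightarrow> b0 J \<in> carrier K \<and> \<iota> (b0 J) = a J"
    by metis
  \<comment> \<open>values outside degree i do not enter the differential on sets with i + 1 elements, so 0 will do\<close>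
  define b where "b J = (if J \<in> N.deg i then b0 J else \<zero>\<^bsub>K\<^esub>)" for J
  have b: "b \<in> K.N.cochains" using b0 by (auto intro!: K.N.cochainsI simp: b_def)
  have ib: "\<iota> (b J) = a J" if "J \<in> N.deg i" for J using that b0 by (simp add: b_def)
  have "K.N.koszul_diff (k + t) b J = \<zero>\<^bsub>K\<^esub>" if J: "J \<in> N.deg (Suc i)" for J
  proof -
    have J': "J \<subseteq> N.idx" using J by (simp add: N.deg_iff)
    have "\<iota> (K.N.koszul_diff (k + t) b J) = N.koszul_diff (k + t) (\<lambda>J. \<iota> (b J)) J"
      using b J' by (rule K.hom_koszul_diff)
    also have "\<dots> = N.koszul_diff (k + t) a J"
    proof (rule N.koszul_diff_cong[OF J' a])
      show "\<iota> (b (J - {j})) = a (J - {j})" if "j \<in> J" for j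
        using that J N.finite_subset_idx[of J] by (intro ib) (auto simp: N.deg_iff)
    qed
    also have "\<dots> = N.yprod J [^] t \<odot>\<^bsub>N\<^esub> N.koszul_diff k u J
        \<oplus>\<^bsub>N\<^esub> (\<ominus> \<one>) \<odot>\<^bsub>N\<^esub> N.koszul_diff (k + t) (N.koszul_diff (k + t) v) J"
    proof -
      have "(\<lambda>J. (\<ominus> \<one>) \<odot>\<^bsub>N\<^esub> N.koszul_diff (k + t) v J) \<in> N.cochains"
        using dv by (auto intro!: N.cochainsI)
      then show ?thesis
        unfolding a_def using yu dv J' u
        by (simp add: N.koszul_diff_add N.koszul_diff_smult N.koszul_diff_yprod_power)
    qed
    also have "\<dots> = \<zero>\<^bsub>N\<^esub>"
      using du J J' v by (simp add: N.koszul_diff_square_zero)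
    finally have "\<iota> (K.N.koszul_diff (k + t) b J) = \<iota> \<zero>\<^bsub>K\<^esub>"
      by (simp add: K.hom_zero)
    then show ?thesis
      using inj b J' by (auto simp: inj_on_def)
  qed
  then have b_cocycle_Ball: "\<forall>J\<in>N.deg (Suc i). K.N.koszul_diff (k + t) b J = \<zero>\<^bsub>K\<^esub>"
    by simp
  obtain t' w where w: "w \<in> K.N.cochains"
    and w_Ball: "\<forall>J\<in>N.deg i. N.yprod J [^] t' \<odot>\<^bsub>K\<^esub> b J = K.N.koszul_diff (k + t + t') w J"
    using K.N.koszul_exactD[OF exK b b_cocycle_Ball] by (elim exE bexE) (rule that)
  note weq = w_Ball[rule_format]
  let ?v = "\<lambda>J. N.yprod J [^] t' \<odot>\<^bsub>N\<^esub> v J \<oplus>\<^bsub>N\<^esub> \<iota> (w J)"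
  have yv: "(\<lambda>J. N.yprod J [^] t' \<odot>\<^bsub>N\<^esub> v J) \<in> N.cochains"
    using v by (auto intro!: N.cochainsI)
  have iw: "(\<lambda>J. \<iota> (w J)) \<in> N.cochains"
    using w by (rule K.hom_cochain)
  have "N.yprod J [^] (t + t') \<odot>\<^bsub>N\<^esub> u J = N.koszul_diff (k + (t + t')) ?v J" if J: "J \<in> N.deg i" for J
  proof -
    have J': "J \<subseteq> N.idx" using J by (simp add: N.deg_iff)
    have c: "u J \<in> carrier N" "N.koszul_diff (k + t) v J \<in> carrier N" "a J \<in> carrier N"
         "N.yprod J \<in> carrier R"
      using u v a J' by auto
    have "N.koszul_diff (k + (t + t')) ?v J
        = N.yprod J [^] t' \<odot>\<^bsub>N\<^esub> N.koszul_diff (k + t) v J \<oplus>\<^bsub>N\<^esub> N.koszul_diff (k + t + t') (\<lambda>J. \<iota> (w J)) J"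
      using yv iw v J' by (simp add: N.koszul_diff_add N.koszul_diff_yprod_power flip: add.assoc)
    also have "N.koszul_diff (k + t + t') (\<lambda>J. \<iota> (w J)) J = N.yprod J [^] t' \<odot>\<^bsub>N\<^esub> a J"
      using weq[OF J] ib[OF J] b J' K.hom_koszul_diff[OF w J', of "k + t + t'"] c
      by (metis K.N.cochainsD K.hom_smult N.R.nat_pow_closed)
    also have "N.yprod J [^] t' \<odot>\<^bsub>N\<^esub> N.koszul_diff (k + t) v J \<oplus>\<^bsub>N\<^esub> N.yprod J [^] t' \<odot>\<^bsub>N\<^esub> a J
        = N.yprod J [^] t' \<odot>\<^bsub>N\<^esub> (N.koszul_diff (k + t) v J \<oplus>\<^bsub>N\<^esub> a J)"
      using c by (simp add: N.smult_r_distr)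
    also have "N.koszul_diff (k + t) v J \<oplus>\<^bsub>N\<^esub> a J = N.yprod J [^] t \<odot>\<^bsub>N\<^esub> u J"
      unfolding a_def using c
      by (subst N.M.a_comm) (simp_all add: N.smult_l_minus N.M.a_assoc N.M.l_neg)
    also have "N.yprod J [^] t' \<odot>\<^bsub>N\<^esub> (N.yprod J [^] t \<odot>\<^bsub>N\<^esub> u J) = N.yprod J [^] (t + t') \<odot>\<^bsub>N\<^esub> u J"
      using c by (simp add: N.smult_assoc1[symmetric] N.R.nat_pow_mult add.commute)
    finally show ?thesis by simp
  qed
  moreover have "?v \<in> N.cochains"
    using yv iw by (auto intro!: N.cochainsI)
  ultimately show "\<exists>t. \<exists>v\<in>N.cochains. \<forall>J\<in>N.deg i. N.yprod J [^] t \<odot>\<^bsub>N\<^esub> u J = N.koszul_diff (k + t) v J"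
    by blast
qed

end


section \<open>Local cohomology in terms of Koszul cochains\<close>

context Module.module
begin

lemma pow_smult_pow_smult:
  fixes a b :: nat
  assumes "f \<in> carrier R" "u \<in> carrier M"
  shows "f [^] a \<odot>\<^bsub>M\<^esub> (f [^] b \<odot>\<^bsub>M\<^esub> u) = f [^] (a + b) \<odot>\<^bsub>M\<^esub> u"
  using assms by (simp add: smult_assoc1[symmetric] R.nat_pow_mult)

lemma mem_loc_frac_iff:
  "(v, l) \<in> loc_frac R M f u k \<longleftrightarrow>
     v \<in> carrier M \<and> (\<exists>t::nat. f [^] (t + l) \<odot>\<^bsub>M\<^esub> u = f [^] (t + k) \<odot>\<^bsub>M\<^esub> v)"
  by (simp add: loc_frac_def)

lemma loc_frac_eq_iff:
  assumes f: "f \<in> carrier R" and u: "u \<in> carrier M" and v: "v \<in> carrier M"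
  shows "loc_frac R M f u k = loc_frac R M f v l \<longleftrightarrow>
    (\<exists>t::nat. f [^] (t + l) \<odot>\<^bsub>M\<^esub> u = f [^] (t + k) \<odot>\<^bsub>M\<^esub> v)"
    (is "_ \<longleftrightarrow> ?rel u k v l")
proof
  assume eq: "loc_frac R M f u k = loc_frac R M f v l"
  have "(v, l) \<in> loc_frac R M f v l" using v by (simp add: mem_loc_frac_iff)
  then show "?rel u k v l" using eq by (metis mem_loc_frac_iff)
next
  have trans: "?rel u k w p" if r: "?rel u k v l" "?rel v l w p"
    and c: "u \<in> carrier M" "v \<in> carrier M" "w \<in> carrier M" for u v w k l p
  proof -
    obtain t s :: nat where t: "f [^] (t + l) \<odot>\<^bsub>M\<^esub> u = f [^] (t + k) \<odot>\<^bsub>M\<^esub> v"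
      and s: "f [^] (s + p) \<odot>\<^bsub>M\<^esub> v = f [^] (s + l) \<odot>\<^bsub>M\<^esub> w"
      using r by blast
    have "f [^] (t + s + l + p) \<odot>\<^bsub>M\<^esub> u = f [^] (s + p) \<odot>\<^bsub>M\<^esub> (f [^] (t + l) \<odot>\<^bsub>M\<^esub> u)"
      using f c by (simp add: pow_smult_pow_smult add_ac)
    also have "\<dots> = f [^] (t + k) \<odot>\<^bsub>M\<^esub> (f [^] (s + p) \<odot>\<^bsub>M\<^esub> v)"
      unfolding t using f c by (simp add: pow_smult_pow_smult add_ac)
    also have "\<dots> = f [^] (t + s + l + k) \<odot>\<^bsub>M\<^esub> w"
      unfolding s using f c by (simp add: pow_smult_pow_smult add_ac)
    finally show ?thesis by blast
  qed
  have sym: "?rel v l u k" if "?rel u k v l" for u v k l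
    using that by metis
  assume rel: "?rel u k v l"
  show "loc_frac R M f u k = loc_frac R M f v l"
  proof (intro equalityI subrelI)
    fix w p
    assume "(w, p) \<in> loc_frac R M f u k"
    then have "w \<in> carrier M" "?rel u k w p" by (simp_all add: mem_loc_frac_iff)
    moreover from this have "?rel v l w p"
      using trans[OF sym[OF rel]] u v by blast
    ultimately show "(w, p) \<in> loc_frac R M f v l" by (simp add: mem_loc_frac_iff)
  next
    fix w p
    assume "(w, p) \<in> loc_frac R M f v l"
    then have "w \<in> carrier M" "?rel v l w p" by (simp_all add: mem_loc_frac_iff)
    moreover from this have "?rel u k w p"
      using trans[OF rel] u v by blast
    ultimately show "(w, p) \<in> loc_frac R M f u k" by (simp add: mem_loc_frac_iff)
  qed
qed

text \<open>
  Operations on fractions are unions over all representatives; this evaluates such a union once the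
  expression is known not to depend on the representative.
\<close>

lemma loc_frac_UN_eq:
  assumes u: "u \<in> carrier M"
    and F: "\<And>v l t. v \<in> carrier M \<Longrightarrow> f [^] (t + l) \<odot>\<^bsub>M\<^esub> u = f [^] (t + k) \<odot>\<^bsub>M\<^esub> v \<Longrightarrow> F v l = F u k"
  shows "(\<Union>(v, l)\<in>loc_frac R M f u k. F v l) = F u k"
proof -
  have "(u, k) \<in> loc_frac R M f u k" using u by (simp add: mem_loc_frac_iff)
  moreover have "F v l = F u k" if "(v, l) \<in> loc_frac R M f u k" for v l
    using that F unfolding mem_loc_frac_iff by blast
  ultimately show ?thesis by fast
qed

lemma loc_frac_raise:
  assumes "f \<in> carrier R" "u \<in> carrier M"
  shows "loc_frac R M f (f [^] t \<odot>\<^bsub>M\<^esub> u) (k + t) = loc_frac R M f u k"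
  using assms by (subst loc_frac_eq_iff) (auto simp: pow_smult_pow_smult add_ac)

lemma loc_frac_carrier: "u \<in> carrier M \<Longrightarrow> loc_frac R M f u k \<in> carrier (localization R M f)"
  by (auto simp: localization_def)

text \<open>
  Every finite family of fractions can be written with one exponent k.  This reduces all
  computations with fractions to computations with numerators.
\<close>

lemma localization_common_denominator:
  assumes f: "f \<in> carrier R" and "finite X" "\<And>x. x \<in> X \<Longrightarrow> c x \<in> carrier (localization R M f)"
  shows "\<exists>k u. \<forall>x\<in>X. u x \<in> carrier M \<and> c x = loc_frac R M f (u x) k"
proof -
  have "\<forall>x\<in>X. \<exists>u k. u \<in> carrier M \<and> c x = loc_frac R M f u k"
    using assms(3) by (fastforce simp: localization_def)
  then obtain u kk where u: "\<And>x. x \<in> X \<Longrightarrow> u x \<in> carrier M \<and> c x = loc_frac R M f (u x) (kk x)"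
    by metis
  define k where "k = (\<Sum>x\<in>X. kk x)"
  have le: "kk x \<le> k" if "x \<in> X" for x
    unfolding k_def using that assms(2) by (intro member_le_sum) auto
  have "c x = loc_frac R M f (f [^] (k - kk x) \<odot>\<^bsub>M\<^esub> u x) k" if "x \<in> X" for x
    using loc_frac_raise[OF f, of "u x" "k - kk x" "kk x"] u[OF that] le[OF that] by simp
  then show ?thesis
    using u f by (intro exI[of _ k] exI[of _ "\<lambda>x. f [^] (k - kk x) \<odot>\<^bsub>M\<^esub> u x"]) auto
qed

lemma localization_add:
  assumes f: "f \<in> carrier R" and u: "u \<in> carrier M" and v: "v \<in> carrier M"
  shows "loc_frac R M f u k \<oplus>\<^bsub>localization R M f\<^esub> loc_frac R M f v k = loc_frac R M f (u \<oplus>\<^bsub>M\<^esub> v) k"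
proof -
  let ?F = "\<lambda>u k v l. loc_frac R M f (f [^] l \<odot>\<^bsub>M\<^esub> u \<oplus>\<^bsub>M\<^esub> f [^] k \<odot>\<^bsub>M\<^esub> v) (k + l)"
  have F1: "?F u' k' v l = ?F u k v l"
    if c: "u \<in> carrier M" "u' \<in> carrier M" "v \<in> carrier M"
      and t: "f [^] (t + k') \<odot>\<^bsub>M\<^esub> u = f [^] (t + k) \<odot>\<^bsub>M\<^esub> u'" for u u' k k' v l t
  proof -
    have "f [^] (t + (k + l)) \<odot>\<^bsub>M\<^esub> (f [^] l \<odot>\<^bsub>M\<^esub> u' \<oplus>\<^bsub>M\<^esub> f [^] k' \<odot>\<^bsub>M\<^esub> v)
        = f [^] (l + l) \<odot>\<^bsub>M\<^esub> (f [^] (t + k) \<odot>\<^bsub>M\<^esub> u') \<oplus>\<^bsub>M\<^esub> f [^] (t + k + l + k') \<odot>\<^bsub>M\<^esub> v"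
      using f c by (simp add: smult_r_distr pow_smult_pow_smult add_ac)
    also have "\<dots> = f [^] (t + (k' + l)) \<odot>\<^bsub>M\<^esub> (f [^] l \<odot>\<^bsub>M\<^esub> u \<oplus>\<^bsub>M\<^esub> f [^] k \<odot>\<^bsub>M\<^esub> v)"
      unfolding t[symmetric] using f c by (simp add: smult_r_distr pow_smult_pow_smult add_ac)
    finally show ?thesis
      using f c by (subst loc_frac_eq_iff) auto
  qed
  have comm: "?F u k v l = ?F v l u k" if "u \<in> carrier M" "v \<in> carrier M" for u v k l
    using that f by (simp add: M.a_comm add.commute)
  have F2: "?F u k v' l' = ?F u k v l"
    if c: "u \<in> carrier M" "v' \<in> carrier M" "v \<in> carrier M"
      and t: "f [^] (t + l') \<odot>\<^bsub>M\<^esub> v = f [^] (t + l) \<odot>\<^bsub>M\<^esub> v'" for u k v v' l l' t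
    using F1[OF c(3,2,1) t, of k] comm[OF c(1,2)] comm[OF c(1,3)] by simp
  have "loc_frac R M f u k \<oplus>\<^bsub>localization R M f\<^esub> loc_frac R M f v k
      = (\<Union>(u', k')\<in>loc_frac R M f u k. \<Union>(v', l')\<in>loc_frac R M f v k. ?F u' k' v' l')"
    by (simp add: localization_def)
  also have "\<dots> = (\<Union>(u', k')\<in>loc_frac R M f u k. ?F u' k' v k)"
  proof -
    have "(\<Union>(v', l')\<in>loc_frac R M f v k. ?F u' k' v' l') = ?F u' k' v k"
      if u': "(u', k') \<in> loc_frac R M f u k" for u' k'
    proof (rule loc_frac_UN_eq[OF v])
      have "u' \<in> carrier M" using u' by (simp add: mem_loc_frac_iff)
      then show "?F u' k' v' l' = ?F u' k' v k"
        if "v' \<in> carrier M" "f [^] (t + l') \<odot>\<^bsub>M\<^esub> v = f [^] (t + k) \<odot>\<^bsub>M\<^esub> v'" for v' l' t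
        using that v by (intro F2)
    qed
    then have "(case x of (u', k') \<Rightarrow> \<Union>(v', l')\<in>loc_frac R M f v k. ?F u' k' v' l')
        = (case x of (u', k') \<Rightarrow> ?F u' k' v k)" if "x \<in> loc_frac R M f u k" for x
      using that by (cases x) (simp only: prod.case)
    then show ?thesis by (intro SUP_cong refl)
  qed
  also have "\<dots> = ?F u k v k"
    using F1 u v by (intro loc_frac_UN_eq) blast+
  also have "\<dots> = loc_frac R M f (f [^] k \<odot>\<^bsub>M\<^esub> (u \<oplus>\<^bsub>M\<^esub> v)) (k + k)"
    using f u v by (simp add: smult_r_distr)
  also have "\<dots> = loc_frac R M f (u \<oplus>\<^bsub>M\<^esub> v) k"
    using f u v by (intro loc_frac_raise) auto
  finally show ?thesis .
qed

lemma localization_zero: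
  assumes "f \<in> carrier R"
  shows "\<zero>\<^bsub>localization R M f\<^esub> = loc_frac R M f \<zero>\<^bsub>M\<^esub> k"
proof -
  have "\<zero>\<^bsub>localization R M f\<^esub> = loc_frac R M f \<zero>\<^bsub>M\<^esub> 0" by (simp add: localization_def)
  also have "\<dots> = loc_frac R M f \<zero>\<^bsub>M\<^esub> k"
    using assms by (subst loc_frac_eq_iff) auto
  finally show ?thesis .
qed

lemma localization_abelian_group:
  assumes f: "f \<in> carrier R"
  shows "abelian_group (localization R M f)"
proof -
  let ?L = "localization R M f"
  have common: "\<exists>k u v w. u \<in> carrier M \<and> v \<in> carrier M \<and> w \<in> carrier M \<and>
      X = loc_frac R M f u k \<and> Y = loc_frac R M f v k \<and> Z = loc_frac R M f w k"
    if XYZ: "X \<in> carrier ?L" "Y \<in> carrier ?L" "Z \<in> carrier ?L" for X Y Z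
  proof -
    have "\<exists>k u. \<forall>x\<in>{X, Y, Z}. u x \<in> carrier M \<and> x = loc_frac R M f (u x) k"
      using XYZ by (intro localization_common_denominator[OF f]) auto
    then obtain k u where "\<forall>x\<in>{X, Y, Z}. u x \<in> carrier M \<and> x = loc_frac R M f (u x) k"
      by (elim exE) (rule that)
    then show ?thesis by (intro exI[of _ k] exI[of _ "u X"] exI[of _ "u Y"] exI[of _ "u Z"]) simp
  qed
  show ?thesis
  proof (rule abelian_groupI)
    fix X Y Z assume X: "X \<in> carrier ?L" and Y: "Y \<in> carrier ?L" and Z: "Z \<in> carrier ?L"
    obtain k u v w where c: "u \<in> carrier M" "v \<in> carrier M" "w \<in> carrier M"
      and eq: "X = loc_frac R M f u k" "Y = loc_frac R M f v k" "Z = loc_frac R M f w k"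
      using common[OF X Y Z] by blast
    show "X \<oplus>\<^bsub>?L\<^esub> Y \<oplus>\<^bsub>?L\<^esub> Z = X \<oplus>\<^bsub>?L\<^esub> (Y \<oplus>\<^bsub>?L\<^esub> Z)"
      using f c by (simp add: eq localization_add M.a_assoc)
  next
    fix X Y assume X: "X \<in> carrier ?L" and Y: "Y \<in> carrier ?L"
    obtain k u v w where c: "u \<in> carrier M" "v \<in> carrier M" "w \<in> carrier M"
      and eq: "X = loc_frac R M f u k" "Y = loc_frac R M f v k"
      using common[OF X Y Y] by blast
    show "X \<oplus>\<^bsub>?L\<^esub> Y \<in> carrier ?L"
      using f c by (simp add: eq localization_add loc_frac_carrier)
    show "X \<oplus>\<^bsub>?L\<^esub> Y = Y \<oplus>\<^bsub>?L\<^esub> X"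
      using f c by (simp add: eq localization_add M.a_comm)
  next
    fix X assume X: "X \<in> carrier ?L"
    obtain k u where c: "u \<in> carrier M" and eq: "X = loc_frac R M f u k"
      using X by (auto simp: localization_def)
    show "\<zero>\<^bsub>?L\<^esub> \<oplus>\<^bsub>?L\<^esub> X = X"
      using f c by (simp add: eq localization_zero[OF f, of k] localization_add)
    show "\<exists>Y\<in>carrier ?L. Y \<oplus>\<^bsub>?L\<^esub> X = \<zero>\<^bsub>?L\<^esub>"
      using f c by (intro bexI[of _ "loc_frac R M f (\<ominus>\<^bsub>M\<^esub> u) k"])
        (simp_all add: eq localization_zero[OF f, of k] localization_add M.l_neg loc_frac_carrier)
  next
    show "\<zero>\<^bsub>?L\<^esub> \<in> carrier ?L"
      using f by (simp add: localization_zero[OF f, of 0] loc_frac_carrier)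
  qed
qed

lemma localization_minus:
  assumes f: "f \<in> carrier R" and u: "u \<in> carrier M"
  shows "\<ominus>\<^bsub>localization R M f\<^esub> loc_frac R M f u k = loc_frac R M f (\<ominus>\<^bsub>M\<^esub> u) k"
proof -
  interpret L: abelian_group "localization R M f" using f by (rule localization_abelian_group)
  show ?thesis
    using f u by (intro L.minus_equality)
      (simp_all add: localization_zero[OF f, of k] localization_add M.l_neg loc_frac_carrier)
qed

lemma localization_finsum:
  assumes f: "f \<in> carrier R" and "finite X" "u \<in> X \<rightarrow> carrier M"
  shows "(\<Oplus>\<^bsub>localization R M f\<^esub>x\<in>X. loc_frac R M f (u x) k) = loc_frac R M f (\<Oplus>\<^bsub>M\<^esub>x\<in>X. u x) k"
  using assms localization_abelian_group[OF f]
  by (intro finsum_hom[symmetric])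
    (auto simp: localization_add loc_frac_carrier M.abelian_group_axioms)

end


context module_sequence
begin

lemma cech_res_loc_frac:
  assumes J: "insert j J \<subseteq> idx" "j \<notin> J" and u: "u \<in> carrier M"
  shows "cech_res R ys M J j (loc_frac R M (yprod J) u k)
       = loc_frac R M (yprod (insert j J)) ((ys ! j) [^] k \<odot>\<^bsub>M\<^esub> u) k"
  unfolding cech_res_def
proof (rule loc_frac_UN_eq[OF u])
  fix v and l t :: nat
  assume v: "v \<in> carrier M"
    and t: "yprod J [^] (t + l) \<odot>\<^bsub>M\<^esub> u = yprod J [^] (t + k) \<odot>\<^bsub>M\<^esub> v"
  let ?y = "ys ! j"
  have c: "?y \<in> carrier R" "yprod J \<in> carrier R" using J by auto
  have y: "yprod (insert j J) = ?y \<otimes> yprod J"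
    using yprod_remove[OF J(1), of j] J(2) by simp
  have "yprod (insert j J) [^] (t + k) \<odot>\<^bsub>M\<^esub> (?y [^] l \<odot>\<^bsub>M\<^esub> v)
      = ?y [^] (t + k + l) \<odot>\<^bsub>M\<^esub> (yprod J [^] (t + k) \<odot>\<^bsub>M\<^esub> v)"
    using c v by (simp add: y R.nat_pow_distrib smult_assoc1[symmetric] R.nat_pow_mult[symmetric] R.m_ac)
  also have "\<dots> = yprod (insert j J) [^] (t + l) \<odot>\<^bsub>M\<^esub> (?y [^] k \<odot>\<^bsub>M\<^esub> u)"
    unfolding t[symmetric]
    using c u by (simp add: y R.nat_pow_distrib smult_assoc1[symmetric] R.nat_pow_mult[symmetric] R.m_ac)
  finally show "loc_frac R M (yprod (insert j J)) (?y [^] l \<odot>\<^bsub>M\<^esub> v) l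
      = loc_frac R M (yprod (insert j J)) (?y [^] k \<odot>\<^bsub>M\<^esub> u) k"
    using c u v J by (subst loc_frac_eq_iff) auto
qed

text \<open>
  The Cech cochain of degree i with component u J / y_J^k at J.  Up to the choice of k and u, every
  Cech cochain has this form, as a common exponent exists for the finitely many sets J.
\<close>

definition cech_class :: "nat \<Rightarrow> nat \<Rightarrow> (nat set \<Rightarrow> 'c) \<Rightarrow> nat set \<Rightarrow> ('c \<times> nat) set" where
  "cech_class i k u = (\<lambda>J\<in>deg i. loc_frac R M (yprod J) (u J) k)"

lemma deg_subset: "J \<in> deg i \<Longrightarrow> J \<subseteq> idx"
  by (simp add: deg_iff)

lemma deg_yprod [simp]: "J \<in> deg i \<Longrightarrow> yprod J \<in> carrier R"
  by (auto dest: deg_subset)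

lemma deg_cochain [simp]: "J \<in> deg i \<Longrightarrow> u \<in> cochains \<Longrightarrow> u J \<in> carrier M"
  by (auto dest: deg_subset)

lemma cech_class_carrier:
  "u \<in> cochains \<Longrightarrow> cech_class i k u \<in> carrier (cech_module R ys M i)"
  by (auto simp: cech_class_def cech_module_def cech_loc_def intro!: loc_frac_carrier)

lemma cech_class_raise:
  assumes "u \<in> cochains"
  shows "cech_class i (k + t) (\<lambda>J. yprod J [^] t \<odot>\<^bsub>M\<^esub> u J) = cech_class i k u"
  unfolding cech_class_def using assms by (intro restrict_ext loc_frac_raise) auto

lemma cech_class_cong:
  assumes "\<And>J. J \<in> deg i \<Longrightarrow> u J = v J"
  shows "cech_class i k u = cech_class i k v"
  unfolding cech_class_def using assms by (intro restrict_ext) simp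

lemma cech_class_eqD:
  assumes u: "u \<in> cochains" and v: "v \<in> cochains" and eq: "cech_class i k u = cech_class i l v"
  obtains t where "\<And>J. J \<in> deg i \<Longrightarrow> yprod J [^] (t + l) \<odot>\<^bsub>M\<^esub> u J = yprod J [^] (t + k) \<odot>\<^bsub>M\<^esub> v J"
proof -
  have "\<exists>t. yprod J [^] (t + l) \<odot>\<^bsub>M\<^esub> u J = yprod J [^] (t + k) \<odot>\<^bsub>M\<^esub> v J" if J: "J \<in> deg i" for J
  proof -
    have "loc_frac R M (yprod J) (u J) k = loc_frac R M (yprod J) (v J) l"
      using fun_cong[OF eq, of J] J by (simp add: cech_class_def)
    then show ?thesis
      using J u v by (subst (asm) loc_frac_eq_iff) auto
  qed
  then obtain tt where tt: "\<And>J. J \<in> deg i \<Longrightarrow> yprod J [^] (tt J + l) \<odot>\<^bsub>M\<^esub> u J = yprod J [^] (tt J + k) \<odot>\<^bsub>M\<^esub> v J"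
    by metis
  define t where "t = (\<Sum>J\<in>deg i. tt J)"
  show thesis
  proof (rule that[of t])
    fix J assume J: "J \<in> deg i"
    have "tt J \<le> t" unfolding t_def using J by (intro member_le_sum) auto
    then obtain r where r: "t = r + tt J" by (metis le_add_diff_inverse2)
    have "yprod J [^] (t + l) \<odot>\<^bsub>M\<^esub> u J = yprod J [^] r \<odot>\<^bsub>M\<^esub> (yprod J [^] (tt J + l) \<odot>\<^bsub>M\<^esub> u J)"
      using J u by (simp add: r pow_smult_pow_smult add.assoc)
    also have "\<dots> = yprod J [^] (t + k) \<odot>\<^bsub>M\<^esub> v J"
      unfolding tt[OF J] using J v by (simp add: r pow_smult_pow_smult add.assoc)
    finally show "yprod J [^] (t + l) \<odot>\<^bsub>M\<^esub> u J = yprod J [^] (t + k) \<odot>\<^bsub>M\<^esub> v J" .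
  qed
qed

lemma cech_carrierE:
  assumes c: "c \<in> carrier (cech_module R ys M i)"
  obtains k u where "u \<in> cochains" "c = cech_class i k u"
proof -
  have "\<exists>u k. u \<in> carrier M \<and> c J = loc_frac R M (yprod J) u k" if J: "J \<in> deg i" for J
  proof -
    have "c J \<in> carrier (localization R M (yprod J))"
      using c J by (auto simp: cech_module_def cech_loc_def)
    then show ?thesis by (fastforce simp: localization_def)
  qed
  then obtain u0 kk where u0: "\<And>J. J \<in> deg i \<Longrightarrow> u0 J \<in> carrier M"
    and c0: "\<And>J. J \<in> deg i \<Longrightarrow> c J = loc_frac R M (yprod J) (u0 J) (kk J)"
    by metis
  define k where "k = (\<Sum>J\<in>deg i. kk J)"
  define u where "u J = (if J \<in> deg i then yprod J [^] (k - kk J) \<odot>\<^bsub>M\<^esub> u0 J else \<zero>\<^bsub>M\<^esub>)" for J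
  show thesis
  proof (rule that)
    show "u \<in> cochains" using u0 by (auto intro!: cochainsI simp: u_def)
    show "c = cech_class i k u"
    proof (rule ext)
      fix J
      show "c J = cech_class i k u J"
      proof (cases "J \<in> deg i")
        case True
        then have "kk J \<le> k" unfolding k_def by (intro member_le_sum) auto
        then have "loc_frac R M (yprod J) (yprod J [^] (k - kk J) \<odot>\<^bsub>M\<^esub> u0 J) k = loc_frac R M (yprod J) (u0 J) (kk J)"
          using loc_frac_raise[of "yprod J" "u0 J" "k - kk J" "kk J"] True u0 by simp
        then show ?thesis using True c0 by (simp add: cech_class_def u_def)
      next
        case False
        have "c \<in> extensional (deg i)" using c by (simp add: cech_module_def PiE_def)
        from extensional_arb[OF this False] show ?thesis
          using False by (simp add: cech_class_def)
      qed
    qed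
  qed
qed

lemma cech_class_add:
  assumes "u \<in> cochains" "v \<in> cochains"
  shows "cech_class i k u \<oplus>\<^bsub>cech_module R ys M i\<^esub> cech_class i k v = cech_class i k (\<lambda>J. u J \<oplus>\<^bsub>M\<^esub> v J)"
  unfolding cech_module_def using assms
  by (auto simp: cech_class_def cech_loc_def localization_add intro!: restrict_ext)

lemma cech_class_zero: "\<zero>\<^bsub>cech_module R ys M i\<^esub> = cech_class i k (\<lambda>_. \<zero>\<^bsub>M\<^esub>)"
  unfolding cech_module_def cech_class_def cech_loc_def
  by (auto intro!: restrict_ext localization_zero)

text \<open>
  On numerators over the k-th powers, the Cech differential is the Koszul differential for y^k: the
  restriction map multiplies a numerator by y_j^k.
\<close>

lemma cech_diff_class:
  assumes u: "u \<in> cochains"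
  shows "cech_diff R ys M i (cech_class i k u) = cech_class (Suc i) k (koszul_diff k u)"
  unfolding cech_diff_def cech_class_def[of "Suc i"]
proof (rule restrict_ext)
  fix J assume J: "J \<in> deg (Suc i)"
  then have J': "J \<subseteq> idx" "card J = Suc i" "finite J" using finite_subset_idx by (auto simp: deg_iff)
  let ?L = "localization R M (yprod J)"
  have L: "abelian_group ?L" using J' by (intro localization_abelian_group) auto
  interpret L: abelian_group ?L by fact
  have "(\<Oplus>\<^bsub>?L\<^esub>j\<in>J. if even (card {l \<in> J. l < j}) then cech_res R ys M (J - {j}) j (cech_class i k u (J - {j}))
           else \<ominus>\<^bsub>?L\<^esub> cech_res R ys M (J - {j}) j (cech_class i k u (J - {j})))
      = (\<Oplus>\<^bsub>?L\<^esub>j\<in>J. loc_frac R M (yprod J) (signed_power k J j \<odot>\<^bsub>M\<^esub> u (J - {j})) k)"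
  proof (rule L.finsum_cong')
    fix j assume j: "j \<in> J"
    have Jj: "J - {j} \<in> deg i" "insert j (J - {j}) = J" "j \<in> idx" using j J' by (auto simp: deg_iff)
    have uj: "u (J - {j}) \<in> carrier M" using u J' by simp
    have "cech_res R ys M (J - {j}) j (cech_class i k u (J - {j}))
        = loc_frac R M (yprod J) ((ys ! j) [^] k \<odot>\<^bsub>M\<^esub> u (J - {j})) k"
      using cech_res_loc_frac[of j "J - {j}" "u (J - {j})" k] Jj uj J' by (simp add: cech_class_def)
    then show "(if even (card {l \<in> J. l < j}) then cech_res R ys M (J - {j}) j (cech_class i k u (J - {j}))
           else \<ominus>\<^bsub>?L\<^esub> cech_res R ys M (J - {j}) j (cech_class i k u (J - {j})))
        = loc_frac R M (yprod J) (signed_power k J j \<odot>\<^bsub>M\<^esub> u (J - {j})) k"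
      using Jj uj J' by (simp add: signed_power_def localization_minus smult_l_minus)
  qed (use u J' in \<open>auto intro!: loc_frac_carrier smult_closed\<close>)
  also have "\<dots> = loc_frac R M (yprod J) (koszul_diff k u J) k"
    unfolding koszul_diff_def using u J' by (intro localization_finsum) auto
  finally show "(\<Oplus>\<^bsub>cech_loc R ys M J\<^esub>j\<in>J. if even (card {l \<in> J. l < j}) then cech_res R ys M (J - {j}) j (cech_class i k u (J - {j}))
           else \<ominus>\<^bsub>cech_loc R ys M J\<^esub> cech_res R ys M (J - {j}) j (cech_class i k u (J - {j})))
      = loc_frac R M (yprod J) (koszul_diff k u J) k"
    unfolding cech_loc_def .
qed

lemma koszul_diff_cochain: "u \<in> cochains \<Longrightarrow> koszul_diff k u \<in> cochains"
  by (auto intro!: cochainsI)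

text \<open>
  In degree 0 the right-hand side is 0 because the Koszul differential vanishes at the empty set, in
  accordance with the convention that only 0 is a coboundary there.
\<close>

lemma cech_coboundaries_eq:
  "cech_coboundaries R ys M i = {cech_class i k (koszul_diff k v) | k v. v \<in> cochains}"
proof (cases i)
  case 0
  have "cech_class 0 k (koszul_diff k v) = \<zero>\<^bsub>cech_module R ys M 0\<^esub>" if "v \<in> cochains" for k v
    unfolding cech_class_zero[of 0 k] using finite_subset_idx
    by (intro cech_class_cong) (auto simp: deg_iff koszul_diff_def)
  moreover have "(\<lambda>_. \<zero>\<^bsub>M\<^esub>) \<in> cochains" by (auto intro!: cochainsI)
  ultimately show ?thesis unfolding 0 cech_coboundaries_def by auto metis
next
  case (Suc j)
  have "cech_class i k (koszul_diff k v) \<in> cech_diff R ys M j ` carrier (cech_module R ys M j)"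
    if "v \<in> cochains" for k v
    using that cech_class_carrier[OF that, of j k] cech_diff_class[OF that, of j k] Suc by force
  moreover have "\<exists>k v. cech_diff R ys M j c = cech_class i k (koszul_diff k v) \<and> v \<in> cochains"
    if "c \<in> carrier (cech_module R ys M j)" for c
    using that by (rule cech_carrierE) (auto simp: cech_diff_class Suc)
  ultimately show ?thesis
    unfolding cech_coboundaries_def by (auto simp: Suc)
qed

text \<open>
  The Koszul differential of the numerators of a Cech cocycle is killed by some power of the y_J.
  Multiplying numerators and denominators by that power makes it vanish.
\<close>

lemma cech_cocyclesE:
  assumes "c \<in> cech_cocycles R ys M i"
  obtains k u where "u \<in> cochains" "c = cech_class i k u" "\<forall>J\<in>deg (Suc i). koszul_diff k u J = \<zero>\<^bsub>M\<^esub>"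
proof -
  have c: "c \<in> carrier (cech_module R ys M i)" and d: "cech_diff R ys M i c = \<zero>\<^bsub>cech_module R ys M (Suc i)\<^esub>"
    using assms by (auto simp: cech_cocycles_def)
  obtain k u where u: "u \<in> cochains" and cu: "c = cech_class i k u" using c by (rule cech_carrierE)
  have "cech_class (Suc i) k (koszul_diff k u) = cech_class (Suc i) 0 (\<lambda>_. \<zero>\<^bsub>M\<^esub>)"
    using d by (simp add: cu cech_diff_class[OF u] cech_class_zero[of _ 0])
  moreover have "(\<lambda>_. \<zero>\<^bsub>M\<^esub>) \<in> cochains" by (auto intro!: cochainsI)
  ultimately obtain t where t: "\<And>J. J \<in> deg (Suc i) \<Longrightarrow>
      yprod J [^] (t + 0) \<odot>\<^bsub>M\<^esub> koszul_diff k u J = yprod J [^] (t + k) \<odot>\<^bsub>M\<^esub> \<zero>\<^bsub>M\<^esub>"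
    using cech_class_eqD[OF koszul_diff_cochain[OF u]] by metis
  show thesis
  proof (rule that)
    show "(\<lambda>J. yprod J [^] t \<odot>\<^bsub>M\<^esub> u J) \<in> cochains" using u by (auto intro!: cochainsI)
    show "c = cech_class i (k + t) (\<lambda>J. yprod J [^] t \<odot>\<^bsub>M\<^esub> u J)"
      using u by (simp add: cu cech_class_raise)
    show "\<forall>J\<in>deg (Suc i). koszul_diff (k + t) (\<lambda>J. yprod J [^] t \<odot>\<^bsub>M\<^esub> u J) J = \<zero>\<^bsub>M\<^esub>"
    proof
      fix J assume J: "J \<in> deg (Suc i)"
      show "koszul_diff (k + t) (\<lambda>J. yprod J [^] t \<odot>\<^bsub>M\<^esub> u J) J = \<zero>\<^bsub>M\<^esub>"
        using t[OF J] koszul_diff_yprod_power[OF u deg_subset[OF J], of k t] J by simp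
    qed
  qed
qed

lemma cech_class_cocycle:
  assumes u: "u \<in> cochains" and "\<And>J. J \<in> deg (Suc i) \<Longrightarrow> koszul_diff k u J = \<zero>\<^bsub>M\<^esub>"
  shows "cech_class i k u \<in> cech_cocycles R ys M i"
  using assms cech_class_carrier[OF u] cech_class_cong[of "Suc i" "koszul_diff k u" "\<lambda>_. \<zero>\<^bsub>M\<^esub>" k]
  by (simp add: cech_cocycles_def cech_diff_class cech_class_zero[of _ k])

text \<open>
  The quotient is trivial iff every coset of the coboundaries by a cocycle is the set of coboundaries
  itself.  For a cocycle that is a coboundary this holds because the coboundaries are closed under
  addition and subtraction, which is checked on numerators over a common power.
\<close>

lemma lc_zero_iff_cocycles_subset:
  "\<not> lc_nonzero R ys M i \<longleftrightarrow> cech_cocycles R ys M i \<subseteq> cech_coboundaries R ys M i"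
proof -
  let ?C = "cech_module R ys M i"
  let ?Z = "cech_cocycles R ys M i"
  let ?B = "cech_coboundaries R ys M i"
  define coset where "coset a = (\<lambda>h. h \<oplus>\<^bsub>?C\<^esub> a) ` ?B" for a
  have zc: "(\<lambda>_. \<zero>\<^bsub>M\<^esub>) \<in> cochains" by (auto intro!: cochainsI)
  have zB: "\<zero>\<^bsub>?C\<^esub> \<in> ?B"
  proof -
    have "\<zero>\<^bsub>?C\<^esub> = cech_class i 0 (koszul_diff 0 (\<lambda>_. \<zero>\<^bsub>M\<^esub>))"
      unfolding cech_class_zero[of i 0] by (intro cech_class_cong) (auto simp: koszul_diff_zero dest: deg_subset)
    then show ?thesis using zc unfolding cech_coboundaries_eq by blast
  qed
  have zZ: "\<zero>\<^bsub>?C\<^esub> \<in> ?Z"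
    unfolding cech_class_zero[of i 0] using zc
    by (intro cech_class_cocycle) (auto simp: koszul_diff_zero dest: deg_subset)
  have left_zero: "\<zero>\<^bsub>?C\<^esub> \<oplus>\<^bsub>?C\<^esub> a = a" if a: "a \<in> ?Z" for a
  proof -
    obtain k u where u: "u \<in> cochains" "a = cech_class i k u"
      using a by (rule cech_cocyclesE)
    have "cech_class i k (\<lambda>J. \<zero>\<^bsub>M\<^esub> \<oplus>\<^bsub>M\<^esub> u J) = cech_class i k u"
      using u by (intro cech_class_cong) simp
    then show ?thesis
      using u zc by (simp add: cech_class_zero[of i k] cech_class_add)
  qed
  have coset_B: "coset a = ?B" if a: "a \<in> ?B" for a
  proof -
    have common: "\<exists>k v w. v \<in> cochains \<and> w \<in> cochains \<and>
        a = cech_class i k (koszul_diff k v) \<and> b = cech_class i k (koszul_diff k w)"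
      if b: "b \<in> ?B" for b
    proof -
      obtain k v l w where kv: "v \<in> cochains" "a = cech_class i k (koszul_diff k v)"
        and lw: "w \<in> cochains" "b = cech_class i l (koszul_diff l w)"
        using a b unfolding cech_coboundaries_eq by blast
      have raise: "cech_class i (k + t) (koszul_diff (k + t) (\<lambda>J. yprod J [^] t \<odot>\<^bsub>M\<^esub> v J)) = cech_class i k (koszul_diff k v)"
        if "v \<in> cochains" for k t v
      proof -
        have "cech_class i (k + t) (koszul_diff (k + t) (\<lambda>J. yprod J [^] t \<odot>\<^bsub>M\<^esub> v J))
            = cech_class i (k + t) (\<lambda>J. yprod J [^] t \<odot>\<^bsub>M\<^esub> koszul_diff k v J)"
          using that by (intro cech_class_cong) (auto simp: koszul_diff_yprod_power dest: deg_subset)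
        also have "\<dots> = cech_class i k (koszul_diff k v)"
          using that by (intro cech_class_raise koszul_diff_cochain)
        finally show ?thesis .
      qed
      show ?thesis
        using raise[OF kv(1), of k l] raise[OF lw(1), of l k] kv lw
        by (intro exI[of _ "k + l"] exI[of _ "\<lambda>J. yprod J [^] l \<odot>\<^bsub>M\<^esub> v J"] exI[of _ "\<lambda>J. yprod J [^] k \<odot>\<^bsub>M\<^esub> w J"])
          (auto intro!: cochainsI simp: add.commute)
    qed
    show ?thesis
    proof (intro equalityI subsetI)
      fix x assume "x \<in> coset a"
      then obtain b where b: "b \<in> ?B" "x = b \<oplus>\<^bsub>?C\<^esub> a" unfolding coset_def by blast
      obtain k v w where v: "v \<in> cochains" "a = cech_class i k (koszul_diff k v)"
        and w: "w \<in> cochains" "b = cech_class i k (koszul_diff k w)"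
        using common[OF b(1)] by blast
      have "x = cech_class i k (koszul_diff k (\<lambda>J. w J \<oplus>\<^bsub>M\<^esub> v J))"
      proof -
        have "x = cech_class i k (\<lambda>J. koszul_diff k w J \<oplus>\<^bsub>M\<^esub> koszul_diff k v J)"
          using b v w koszul_diff_cochain by (simp add: cech_class_add)
        also have "\<dots> = cech_class i k (koszul_diff k (\<lambda>J. w J \<oplus>\<^bsub>M\<^esub> v J))"
          using v w by (intro cech_class_cong) (auto simp: koszul_diff_add dest: deg_subset)
        finally show ?thesis .
      qed
      moreover have "(\<lambda>J. w J \<oplus>\<^bsub>M\<^esub> v J) \<in> cochains" using v w by (auto intro!: cochainsI)
      ultimately show "x \<in> ?B" unfolding cech_coboundaries_eq by blast
    next
      fix x assume "x \<in> ?B"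
      then obtain k v w where v: "v \<in> cochains" "a = cech_class i k (koszul_diff k v)"
        and w: "w \<in> cochains" "x = cech_class i k (koszul_diff k w)"
        using common by blast
      let ?d = "\<lambda>J. w J \<oplus>\<^bsub>M\<^esub> (\<ominus> \<one>) \<odot>\<^bsub>M\<^esub> v J"
      have mv: "(\<lambda>J. (\<ominus> \<one>) \<odot>\<^bsub>M\<^esub> v J) \<in> cochains" using v by (auto intro!: cochainsI)
      have d: "?d \<in> cochains" using v w by (auto intro!: cochainsI)
      have "cech_class i k (koszul_diff k ?d) \<oplus>\<^bsub>?C\<^esub> a = cech_class i k (\<lambda>J. koszul_diff k ?d J \<oplus>\<^bsub>M\<^esub> koszul_diff k v J)"
        using d v koszul_diff_cochain by (simp add: cech_class_add)
      also have "\<dots> = x"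
        unfolding w(2)
      proof (rule cech_class_cong)
        fix J assume "J \<in> deg i"
        then have J: "J \<subseteq> idx" by (rule deg_subset)
        have "koszul_diff k ?d J = koszul_diff k w J \<oplus>\<^bsub>M\<^esub> \<ominus>\<^bsub>M\<^esub> koszul_diff k v J"
          using w v mv J by (simp add: koszul_diff_add koszul_diff_smult smult_l_minus)
        then show "koszul_diff k ?d J \<oplus>\<^bsub>M\<^esub> koszul_diff k v J = koszul_diff k w J"
          using w v J by (simp add: M.a_assoc M.l_neg)
      qed
      finally show "x \<in> coset a"
        using d unfolding cech_coboundaries_eq coset_def by blast
    qed
  qed
  have "carrier (local_cohomology R ys M i) = coset ` ?Z"
    by (auto simp: local_cohomology_def module_quot_def A_RCOSETS_def' a_r_coset_def' coset_def)
  moreover have "\<zero>\<^bsub>local_cohomology R ys M i\<^esub> = ?B"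
    by (simp add: local_cohomology_def module_quot_def)
  ultimately have "\<not> lc_nonzero R ys M i \<longleftrightarrow> coset ` ?Z = {?B}"
    by (simp add: lc_nonzero_def)
  also have "\<dots> \<longleftrightarrow> ?Z \<subseteq> ?B"
  proof
    assume eq: "coset ` ?Z = {?B}"
    show "?Z \<subseteq> ?B"
    proof
      fix a assume a: "a \<in> ?Z"
      then have "coset a \<in> {?B}" unfolding eq[symmetric] by (rule imageI)
      then have "coset a = ?B" by (rule singletonD)
      moreover have "a \<in> coset a"
        unfolding coset_def using left_zero[OF a, symmetric] zB by (rule image_eqI)
      ultimately show "a \<in> ?B" by simp
    qed
  next
    assume sub: "?Z \<subseteq> ?B"
    have "coset ` ?Z = (\<lambda>_. ?B) ` ?Z"
      by (rule image_cong[OF refl]) (rule coset_B[OF subsetD[OF sub]])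
    then show "coset ` ?Z = {?B}" using zZ by (simp add: image_constant)
  qed
  finally show ?thesis .
qed

theorem lc_zero_iff_koszul_exact: "\<not> lc_nonzero R ys M i \<longleftrightarrow> koszul_exact i"
  unfolding lc_zero_iff_cocycles_subset
proof
  assume sub: "cech_cocycles R ys M i \<subseteq> cech_coboundaries R ys M i"
  show "koszul_exact i"
    unfolding koszul_exact_def
  proof (intro allI ballI impI)
    fix k u assume u: "u \<in> cochains" and du: "\<forall>J\<in>deg (Suc i). koszul_diff k u J = \<zero>\<^bsub>M\<^esub>"
    then have "cech_class i k u \<in> cech_coboundaries R ys M i"
      using sub cech_class_cocycle by blast
    then obtain l v where v: "v \<in> cochains" and eq: "cech_class i k u = cech_class i l (koszul_diff l v)"
      unfolding cech_coboundaries_eq by blast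
    obtain t where t: "\<And>J. J \<in> deg i \<Longrightarrow>
        yprod J [^] (t + l) \<odot>\<^bsub>M\<^esub> u J = yprod J [^] (t + k) \<odot>\<^bsub>M\<^esub> koszul_diff l v J"
      using cech_class_eqD[OF u koszul_diff_cochain[OF v] eq] by metis
    show "\<exists>t. \<exists>v\<in>cochains. \<forall>J\<in>deg i. yprod J [^] t \<odot>\<^bsub>M\<^esub> u J = koszul_diff (k + t) v J"
    proof (intro exI bexI ballI)
      show "(\<lambda>J. yprod J [^] (t + k) \<odot>\<^bsub>M\<^esub> v J) \<in> cochains" using v by (auto intro!: cochainsI)
      fix J assume J: "J \<in> deg i"
      have "k + (t + l) = l + (t + k)" by simp
      then show "yprod J [^] (t + l) \<odot>\<^bsub>M\<^esub> u J = koszul_diff (k + (t + l)) (\<lambda>J. yprod J [^] (t + k) \<odot>\<^bsub>M\<^esub> v J) J"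
        by (simp only: t[OF J] koszul_diff_yprod_power[OF v deg_subset[OF J]])
    qed
  qed
next
  assume exact: "koszul_exact i"
  show "cech_cocycles R ys M i \<subseteq> cech_coboundaries R ys M i"
  proof
    fix c assume "c \<in> cech_cocycles R ys M i"
    then obtain k u where u: "u \<in> cochains" and c: "c = cech_class i k u"
      and du: "\<forall>J\<in>deg (Suc i). koszul_diff k u J = \<zero>\<^bsub>M\<^esub>"
      by (rule cech_cocyclesE)
    obtain t v where v: "v \<in> cochains"
      and eq: "\<forall>J\<in>deg i. yprod J [^] t \<odot>\<^bsub>M\<^esub> u J = koszul_diff (k + t) v J"
      using koszul_exactD[OF exact u du] by (elim exE bexE) (rule that)
    have "c = cech_class i (k + t) (\<lambda>J. yprod J [^] t \<odot>\<^bsub>M\<^esub> u J)"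
      using u by (simp add: c cech_class_raise)
    also have "\<dots> = cech_class i (k + t) (koszul_diff (k + t) v)"
      using eq by (intro cech_class_cong) simp
    finally show "c \<in> cech_coboundaries R ys M i"
      using v unfolding cech_coboundaries_eq by blast
  qed
qed

end


section \<open>Submodules and quotient modules\<close>

context Module.module
begin

lemma submodule_abelian_subgroup:
  assumes "submodule A R M"
  shows "abelian_subgroup A M"
  using assms
  by (intro abelian_subgroupI3 additive_subgroupI submodule.axioms(1)) (auto intro: M.abelian_group_axioms)

lemma submodule_finsum_closed:
  assumes "submodule A R M" "finite X" "f \<in> X \<rightarrow> A"
  shows "(\<Oplus>\<^bsub>M\<^esub>x\<in>X. f x) \<in> A"
  using assms(2,3)
proof (induction X)
  case empty
  interpret abelian_subgroup A M using assms(1) by (rule submodule_abelian_subgroup)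
  show ?case by simp
next
  case (insert x X)
  have "f \<in> X \<rightarrow> carrier M" "f x \<in> carrier M"
    using insert.prems submoduleE(1)[OF assms(1)] by auto
  then show ?case
    using insert submoduleE(5)[OF assms(1)] by (simp add: M.finsum_insert)
qed

lemma submodule_restrict:
  assumes A: "submodule A R M" and B: "submodule B R M" and AB: "A \<subseteq> B"
  shows "submodule A R (M\<lparr>carrier := B\<rparr>)"
proof -
  interpret B: Module.module R "M\<lparr>carrier := B\<rparr>"
    using submodule.submodule_is_module[OF B] module_axioms by simp
  have "Module.module R (M\<lparr>carrier := A\<rparr>)"
    using submodule.submodule_is_module[OF A] module_axioms by simp
  then show ?thesis
    using AB by (intro B.module_incl_imp_submodule) simp_all
qed

lemma module_quot_carrier:
  "carrier (module_quot M A) = (\<lambda>x. A +>\<^bsub>M\<^esub> x) ` carrier M"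
  by (auto simp: module_quot_def A_RCOSETS_def')

lemma module_quot_add:
  assumes "submodule A R M" "x \<in> carrier M" "y \<in> carrier M"
  shows "(A +>\<^bsub>M\<^esub> x) \<oplus>\<^bsub>module_quot M A\<^esub> (A +>\<^bsub>M\<^esub> y) = A +>\<^bsub>M\<^esub> (x \<oplus>\<^bsub>M\<^esub> y)"
proof -
  interpret abelian_subgroup A M using assms(1) by (rule submodule_abelian_subgroup)
  show ?thesis using assms by (simp add: module_quot_def a_rcos_sum)
qed

lemma module_quot_smult:
  assumes A: "submodule A R M" and a: "a \<in> carrier R" and x: "x \<in> carrier M"
  shows "a \<odot>\<^bsub>module_quot M A\<^esub> (A +>\<^bsub>M\<^esub> x) = A +>\<^bsub>M\<^esub> (a \<odot>\<^bsub>M\<^esub> x)"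
proof -
  interpret abelian_subgroup A M using A by (rule submodule_abelian_subgroup)
  have "A +>\<^bsub>M\<^esub> (a \<odot>\<^bsub>M\<^esub> z) = A +>\<^bsub>M\<^esub> (a \<odot>\<^bsub>M\<^esub> x)" if z: "z \<in> A +>\<^bsub>M\<^esub> x" for z
  proof -
    obtain h where h: "h \<in> A" "z = h \<oplus>\<^bsub>M\<^esub> x" using z by (auto simp: a_r_coset_def')
    have hM: "h \<in> carrier M" using h submoduleE(1)[OF A] by auto
    have "a \<odot>\<^bsub>M\<^esub> z = a \<odot>\<^bsub>M\<^esub> h \<oplus>\<^bsub>M\<^esub> a \<odot>\<^bsub>M\<^esub> x"
      using h hM a x by (simp add: smult_r_distr)
    then have "a \<odot>\<^bsub>M\<^esub> z \<in> A +>\<^bsub>M\<^esub> (a \<odot>\<^bsub>M\<^esub> x)"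
      using submoduleE(4)[OF A a h(1)] by (auto simp: a_r_coset_def')
    then show ?thesis
      using a x by (intro a_repr_independence'[symmetric]) auto
  qed
  moreover have "x \<in> A +>\<^bsub>M\<^esub> x" using x by (rule a_rcos_self)
  ultimately have "(\<Union>z\<in>A +>\<^bsub>M\<^esub> x. A +>\<^bsub>M\<^esub> (a \<odot>\<^bsub>M\<^esub> z)) = A +>\<^bsub>M\<^esub> (a \<odot>\<^bsub>M\<^esub> x)"
    by blast
  then show ?thesis by (simp add: module_quot_def)
qed

lemma module_quot_zero:
  assumes "submodule A R M"
  shows "\<zero>\<^bsub>module_quot M A\<^esub> = A +>\<^bsub>M\<^esub> \<zero>\<^bsub>M\<^esub>"
proof -
  interpret abelian_subgroup A M using assms(1) by (rule submodule_abelian_subgroup)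
  show ?thesis by (simp add: module_quot_def a_rcos_const)
qed

lemma module_quot_is_module:
  assumes A: "submodule A R M"
  shows "Module.module R (module_quot M A)"
proof -
  note ops = module_quot_carrier module_quot_add[OF A] module_quot_smult[OF A] module_quot_zero[OF A]
  show ?thesis
  proof (rule Module.moduleI)
    show "cring R" by (rule R.is_cring)
    show "abelian_group (module_quot M A)"
    proof (rule abelian_groupI)
      show "\<exists>Y\<in>carrier (module_quot M A). Y \<oplus>\<^bsub>module_quot M A\<^esub> X = \<zero>\<^bsub>module_quot M A\<^esub>"
        if X: "X \<in> carrier (module_quot M A)" for X
      proof -
        obtain x where x: "x \<in> carrier M" "X = A +>\<^bsub>M\<^esub> x" using X by (auto simp: ops)
        then show ?thesis
          by (intro bexI[of _ "A +>\<^bsub>M\<^esub> (\<ominus>\<^bsub>M\<^esub> x)"]) (auto simp: ops M.l_neg)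
      qed
    qed (auto simp: ops M.a_ac)
  qed (auto simp: ops smult_l_distr smult_r_distr smult_assoc1)
qed

end


context module_sequence
begin

lemma module_sequence_submodule:
  assumes "submodule B R M"
  shows "module_sequence R (M\<lparr>carrier := B\<rparr>) ys"
  using submodule.submodule_is_module[OF assms module_axioms] ys_closed
  by (simp add: module_sequence_def module_sequence_axioms_def)

lemma module_sequence_quot:
  assumes "submodule A R M"
  shows "module_sequence R (module_quot M A) ys"
  using module_quot_is_module[OF assms] ys_closed
  by (simp add: module_sequence_def module_sequence_axioms_def)

lemma submodule_inclusion_hom_carrier:
  assumes A: "submodule A R M"
  shows "module_sequence_hom R (M\<lparr>carrier := A\<rparr>) M ys (\<lambda>x. x)"
  using module_sequence_submodule[OF A] module_sequence_axioms submoduleE(1)[OF A]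
  by (auto simp: module_sequence_hom_def module_sequence_hom_axioms_def)

lemma quotient_hom:
  assumes A: "submodule A R M"
  shows "module_sequence_hom R M (module_quot M A) ys (\<lambda>x. A +>\<^bsub>M\<^esub> x)"
  using module_sequence_quot[OF A] module_sequence_axioms
  by (auto simp: module_sequence_hom_def module_sequence_hom_axioms_def
      module_quot_carrier module_quot_add[OF A] module_quot_smult[OF A])

lemma lc_zero_extension:
  assumes A: "submodule A R M"
    and "\<not> lc_nonzero R ys (M\<lparr>carrier := A\<rparr>) i" "\<not> lc_nonzero R ys (module_quot M A) i"
  shows "\<not> lc_nonzero R ys M i"
proof -
  interpret sub: module_sequence R "M\<lparr>carrier := A\<rparr>" ys using A by (rule module_sequence_submodule)
  interpret quot: module_sequence_hom R M "module_quot M A" ys "\<lambda>x. A +>\<^bsub>M\<^esub> x"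
    using A by (rule quotient_hom)
  interpret abelian_subgroup A M using A by (rule submodule_abelian_subgroup)
  have "koszul_exact i"
  proof (rule quot.koszul_exact_extension)
    show "module_sequence_hom R (M\<lparr>carrier := A\<rparr>) M ys (\<lambda>x. x)"
      using A by (rule submodule_inclusion_hom_carrier)
    show "sub.koszul_exact i" using assms(2) sub.lc_zero_iff_koszul_exact by simp
    show "quot.P.koszul_exact i" using assms(3) quot.P.lc_zero_iff_koszul_exact by simp
    show "\<exists>x\<in>carrier M. A +>\<^bsub>M\<^esub> x = z" if "z \<in> carrier (module_quot M A)" for z
      using that by (auto simp: module_quot_carrier)
    show "x \<in> (\<lambda>x. x) ` carrier (M\<lparr>carrier := A\<rparr>)"
      if "x \<in> carrier M" "A +>\<^bsub>M\<^esub> x = \<zero>\<^bsub>module_quot M A\<^esub>" for x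
      using a_rcos_self[OF that(1)] that(2) by (simp add: module_quot_def)
  qed simp
  then show ?thesis using lc_zero_iff_koszul_exact by simp
qed

lemma lc_zero_trivial:
  assumes "carrier M = {\<zero>\<^bsub>M\<^esub>}"
  shows "\<not> lc_nonzero R ys M i"
proof -
  have "koszul_exact i"
    unfolding koszul_exact_def
  proof (intro allI ballI impI)
    fix k u assume u: "u \<in> cochains"
    have zero: "x = \<zero>\<^bsub>M\<^esub>" if "x \<in> carrier M" for x using that assms by simp
    show "\<exists>t. \<exists>v\<in>cochains. \<forall>J\<in>deg i. yprod J [^] t \<odot>\<^bsub>M\<^esub> u J = koszul_diff (k + t) v J"
    proof (intro exI bexI ballI)
      fix J assume J: "J \<in> deg i"
      have "yprod J [^] (0::nat) \<odot>\<^bsub>M\<^esub> u J \<in> carrier M" "koszul_diff (k + 0) u J \<in> carrier M"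
        using u J by (auto dest: deg_subset)
      then show "yprod J [^] (0::nat) \<odot>\<^bsub>M\<^esub> u J = koszul_diff (k + 0) u J"
        using zero by metis
    qed (rule u)
  qed
  then show ?thesis using lc_zero_iff_koszul_exact by simp
qed

text \<open>
  The vanishing gap for the projection from D to M / A, with the resulting combination in M / A
  lifted to M.
\<close>

lemma submodule_elem_power_approx:
  fixes T :: nat
  assumes A: "submodule A R M" and D: "submodule D R M"
    and lcD: "\<And>i. c \<le> i \<Longrightarrow> \<not> lc_nonzero R ys (M\<lparr>carrier := D\<rparr>) i"
    and lcQ: "\<And>i. i < c \<Longrightarrow> \<not> lc_nonzero R ys (module_quot M A) i"
    and x: "x \<in> D"
  shows "\<exists>a\<in>A. \<exists>v\<in>idx \<rightarrow> carrier M. x = a \<oplus>\<^bsub>M\<^esub> (\<Oplus>\<^bsub>M\<^esub>j\<in>idx. (ys ! j) [^] T \<odot>\<^bsub>M\<^esub> v j)"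
proof -
  interpret D: module_sequence R "M\<lparr>carrier := D\<rparr>" ys using D by (rule module_sequence_submodule)
  interpret quot: module_sequence_hom R M "module_quot M A" ys "\<lambda>x. A +>\<^bsub>M\<^esub> x"
    using A by (rule quotient_hom)
  interpret abelian_subgroup A M using A by (rule submodule_abelian_subgroup)
  have DM: "D \<subseteq> carrier M" using submoduleE(1)[OF D] .
  interpret to_quot: module_sequence_hom R "M\<lparr>carrier := D\<rparr>" "module_quot M A" ys "\<lambda>x. A +>\<^bsub>M\<^esub> x"
  proof
    fix y z a assume "y \<in> carrier (M\<lparr>carrier := D\<rparr>)" "z \<in> carrier (M\<lparr>carrier := D\<rparr>)"
    then have yz: "y \<in> carrier M" "z \<in> carrier M" using DM by auto
    then show "A +>\<^bsub>M\<^esub> y \<in> carrier (module_quot M A)" by auto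
    show "A +>\<^bsub>M\<^esub> (y \<oplus>\<^bsub>M\<lparr>carrier := D\<rparr>\<^esub> z) = (A +>\<^bsub>M\<^esub> y) \<oplus>\<^bsub>module_quot M A\<^esub> (A +>\<^bsub>M\<^esub> z)"
      using yz by (simp add: quot.hom_add)
    show "A +>\<^bsub>M\<^esub> (a \<odot>\<^bsub>M\<lparr>carrier := D\<rparr>\<^esub> y) = a \<odot>\<^bsub>module_quot M A\<^esub> (A +>\<^bsub>M\<^esub> y)" if "a \<in> carrier R"
      using yz that by (simp add: quot.hom_smult)
  qed
  obtain w where w: "w \<in> idx \<rightarrow> carrier (module_quot M A)"
    and xw: "A +>\<^bsub>M\<^esub> x = (\<Oplus>\<^bsub>module_quot M A\<^esub>j\<in>idx. (ys ! j) [^] T \<odot>\<^bsub>module_quot M A\<^esub> w j)"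
  proof (rule to_quot.hom_image_in_power_submodule[of c x T])
    show "D.koszul_exact i" if "c \<le> i" for i using lcD[OF that] D.lc_zero_iff_koszul_exact by simp
    show "quot.P.koszul_exact i" if "i < c" for i using lcQ[OF that] quot.P.lc_zero_iff_koszul_exact by simp
    show "x \<in> carrier (M\<lparr>carrier := D\<rparr>)" using x by simp
  qed (rule that)
  have "\<forall>j\<in>idx. \<exists>v\<in>carrier M. w j = A +>\<^bsub>M\<^esub> v"
    using w by (auto simp: module_quot_carrier)
  then obtain v where v: "v \<in> idx \<rightarrow> carrier M" and wv: "\<And>j. j \<in> idx \<Longrightarrow> w j = A +>\<^bsub>M\<^esub> v j"
    by (metis Pi_I)
  let ?s = "\<Oplus>\<^bsub>M\<^esub>j\<in>idx. (ys ! j) [^] T \<odot>\<^bsub>M\<^esub> v j"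
  have yv: "(\<lambda>j. (ys ! j) [^] T \<odot>\<^bsub>M\<^esub> v j) \<in> idx \<rightarrow> carrier M" using v by auto
  have s: "?s \<in> carrier M" using yv by (rule M.finsum_closed)
  have "A +>\<^bsub>M\<^esub> ?s = (\<Oplus>\<^bsub>module_quot M A\<^esub>j\<in>idx. A +>\<^bsub>M\<^esub> ((ys ! j) [^] T \<odot>\<^bsub>M\<^esub> v j))"
    using finite_idx yv by (rule quot.hom_finsum)
  also have "\<dots> = (\<Oplus>\<^bsub>module_quot M A\<^esub>j\<in>idx. (ys ! j) [^] T \<odot>\<^bsub>module_quot M A\<^esub> w j)"
  proof (rule quot.P.M.finsum_cong')
    show "A +>\<^bsub>M\<^esub> ((ys ! j) [^] T \<odot>\<^bsub>M\<^esub> v j) = (ys ! j) [^] T \<odot>\<^bsub>module_quot M A\<^esub> w j" if "j \<in> idx" for j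
      using that v by (subst quot.hom_smult) (auto simp: wv)
  qed (use w in auto)
  finally have "A +>\<^bsub>M\<^esub> x = A +>\<^bsub>M\<^esub> ?s" using xw by simp
  then have "x \<in> A +>\<^bsub>M\<^esub> ?s"
    using a_rcos_self[of x] x DM by auto
  then show ?thesis using v by (auto simp: a_r_coset_def')
qed

end


section \<open>Homogeneous parts and y-degrees\<close>

locale bigraded =
  fixes m n :: nat and M :: "('k::field bipoly, 'b) module" (structure) and G :: "int \<times> int \<Rightarrow> 'b set"
  assumes bigraded: "bigraded_module m n M G"
begin

abbreviation S :: "'k bipoly ring" where
  "S \<equiv> bipoly_ring m n"

lemma is_module: "Module.module S M"
  using bigraded by (simp add: bigraded_module_def)

sublocale Module.module S M
  by (rule is_module)

lemma component_subgroup: "subgroup (G d) (add_monoid M)"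
  using bigraded unfolding bigraded_module_def by blast

lemma component_subset: "G d \<subseteq> carrier M"
  using subgroup.subset[OF component_subgroup[of d]] by simp

lemma component_zero: "\<zero> \<in> G d"
  using subgroup.one_closed[OF component_subgroup[of d]] by simp

lemma component_add: "u \<in> G d \<Longrightarrow> v \<in> G d \<Longrightarrow> u \<oplus> v \<in> G d"
  using subgroup.m_closed[OF component_subgroup[of d]] by simp

lemma component_smult: "p \<in> bipoly_homog m n d \<Longrightarrow> u \<in> G e \<Longrightarrow> p \<odot> u \<in> G (d + e)"
  using bigraded unfolding bigraded_module_def by blast

definition is_decomposition :: "'b \<Rightarrow> (int \<times> int \<Rightarrow> 'b) \<Rightarrow> bool" where
  "is_decomposition u c \<longleftrightarrow>
     (\<forall>d. c d \<in> G d) \<and> finite {d. c d \<noteq> \<zero>} \<and> u = (\<Oplus>d\<in>{d. c d \<noteq> \<zero>}. c d)"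

definition homog_part :: "'b \<Rightarrow> int \<times> int \<Rightarrow> 'b" where
  "homog_part u = (THE c. is_decomposition u c)"

lemma ex1_decomposition: "u \<in> carrier M \<Longrightarrow> \<exists>!c. is_decomposition u c"
  using bigraded unfolding bigraded_module_def is_decomposition_def by blast

lemma is_decomposition_homog_part: "u \<in> carrier M \<Longrightarrow> is_decomposition u (homog_part u)"
  unfolding homog_part_def by (rule theI'[OF ex1_decomposition])

lemma homog_part_eqI: "u \<in> carrier M \<Longrightarrow> is_decomposition u c \<Longrightarrow> homog_part u = c"
  using ex1_decomposition is_decomposition_homog_part by blast

lemma homog_part_in_component: "u \<in> carrier M \<Longrightarrow> homog_part u d \<in> G d"
  using is_decomposition_homog_part unfolding is_decomposition_def by blast

lemma homog_part_closed [simp]: "u \<in> carrier M \<Longrightarrow> homog_part u d \<in> carrier M"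
  using homog_part_in_component component_subset by blast

lemma finite_homog_part_support: "u \<in> carrier M \<Longrightarrow> finite {d. homog_part u d \<noteq> \<zero>}"
  using is_decomposition_homog_part by (simp add: is_decomposition_def)

lemma finsum_support:
  assumes "finite X" "{d. c d \<noteq> \<zero>} \<subseteq> X" "\<And>d. c d \<in> carrier M"
  shows "(\<Oplus>d\<in>X. c d) = (\<Oplus>d\<in>{d. c d \<noteq> \<zero>}. c d)"
  using assms by (intro M.add.finprod_mono_neutral_cong_right) auto

lemma is_decompositionI:
  assumes "\<And>d. c d \<in> G d" "finite X" "{d. c d \<noteq> \<zero>} \<subseteq> X" "u = (\<Oplus>d\<in>X. c d)"
  shows "is_decomposition u c"
proof -
  have "\<And>d. c d \<in> carrier M" using assms(1) component_subset by blast
  then show ?thesis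
    unfolding is_decomposition_def using assms finsum_support[OF assms(2,3)] finite_subset[OF assms(3,2)] by simp
qed

lemma sum_homog_part:
  assumes "u \<in> carrier M" "finite X" "{d. homog_part u d \<noteq> \<zero>} \<subseteq> X"
  shows "u = (\<Oplus>d\<in>X. homog_part u d)"
  using finsum_support[OF assms(2,3)] is_decomposition_homog_part[OF assms(1)] assms(1)
  by (simp add: is_decomposition_def)

lemma homog_part_add:
  assumes u: "u \<in> carrier M" and v: "v \<in> carrier M"
  shows "homog_part (u \<oplus> v) d = homog_part u d \<oplus> homog_part v d"
proof -
  let ?X = "{d. homog_part u d \<noteq> \<zero>} \<union> {d. homog_part v d \<noteq> \<zero>}"
  have fin: "finite ?X" using finite_homog_part_support u v by simp
  have "is_decomposition (u \<oplus> v) (\<lambda>d. homog_part u d \<oplus> homog_part v d)"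
  proof (rule is_decompositionI)
    show "homog_part u d \<oplus> homog_part v d \<in> G d" for d
      using u v by (intro component_add homog_part_in_component)
    show "{d. homog_part u d \<oplus> homog_part v d \<noteq> \<zero>} \<subseteq> ?X" using u v by auto
    have "u \<oplus> v = (\<Oplus>d\<in>?X. homog_part u d) \<oplus> (\<Oplus>d\<in>?X. homog_part v d)"
      using sum_homog_part[OF u fin] sum_homog_part[OF v fin] by simp
    also have "\<dots> = (\<Oplus>d\<in>?X. homog_part u d \<oplus> homog_part v d)"
      using u v by (intro M.finsum_addf[symmetric]) auto
    finally show "u \<oplus> v = (\<Oplus>d\<in>?X. homog_part u d \<oplus> homog_part v d)" .
  qed (rule fin)
  then show ?thesis
    using homog_part_eqI[of "u \<oplus> v"] u v by simp
qed

lemma homog_part_smult: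
  assumes p: "p \<in> bipoly_homog m n e" and u: "u \<in> carrier M"
  shows "homog_part (p \<odot> u) d = p \<odot> homog_part u (d - e)"
proof -
  have pS: "p \<in> carrier S" using p by (simp add: bipoly_homog_def)
  let ?X = "{d. homog_part u d \<noteq> \<zero>}"
  have fin: "finite ?X" using finite_homog_part_support u by simp
  have "is_decomposition (p \<odot> u) (\<lambda>d. p \<odot> homog_part u (d - e))"
  proof (rule is_decompositionI)
    show "p \<odot> homog_part u (d - e) \<in> G d" for d
      using component_smult[OF p homog_part_in_component[OF u], of "d - e"] by simp
    show "finite ((\<lambda>d. d + e) ` ?X)" using fin by simp
    show "{d. p \<odot> homog_part u (d - e) \<noteq> \<zero>} \<subseteq> (\<lambda>d. d + e) ` ?X"
    proof
      fix d assume "d \<in> {d. p \<odot> homog_part u (d - e) \<noteq> \<zero>}"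
      then have "homog_part u (d - e) \<noteq> \<zero>" using pS by auto
      then show "d \<in> (\<lambda>d. d + e) ` ?X" by (intro image_eqI[of _ _ "d - e"]) simp_all
    qed
    have "p \<odot> u = (\<Oplus>d\<in>?X. p \<odot> homog_part u d)"
      using sum_homog_part[OF u fin] finsum_smult_ldistr[OF fin pS, of "homog_part u"] u by simp
    also have "\<dots> = (\<Oplus>d\<in>(\<lambda>d. d + e) ` ?X. p \<odot> homog_part u (d - e))"
      using pS u by (subst M.finsum_reindex) (auto intro!: inj_onI)
    finally show "p \<odot> u = (\<Oplus>d\<in>(\<lambda>d. d + e) ` ?X. p \<odot> homog_part u (d - e))" .
  qed
  then show ?thesis
    using homog_part_eqI[of "p \<odot> u"] u pS by simp
qed

lemma homog_part_zero: "homog_part \<zero> d = \<zero>"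
proof -
  have "is_decomposition \<zero> (\<lambda>_. \<zero>)"
    by (rule is_decompositionI[of _ "{}"]) (auto simp: component_zero)
  then show ?thesis using homog_part_eqI[of \<zero>] by simp
qed

lemma homog_part_bigraded_submodule:
  assumes "bigraded_submodule m n M G N" "u \<in> N"
  shows "homog_part u d \<in> N"
proof -
  obtain c where c: "\<forall>d. c d \<in> N \<inter> G d" "finite {d. c d \<noteq> \<zero>}" "u = (\<Oplus>d\<in>{d. c d \<noteq> \<zero>}. c d)"
    using assms unfolding bigraded_submodule_def by blast
  then have "is_decomposition u c" by (simp add: is_decomposition_def)
  moreover have "u \<in> carrier M"
    using assms submoduleE(1) unfolding bigraded_submodule_def by blast
  ultimately have "homog_part u = c" by (intro homog_part_eqI)
  then show ?thesis using c(1) by blast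
qed

lemma submodule_memI:
  assumes "submodule N S M" "u \<in> carrier M" "\<And>d. homog_part u d \<in> N"
  shows "u \<in> N"
proof -
  have "(\<Oplus>d\<in>{d. homog_part u d \<noteq> \<zero>}. homog_part u d) \<in> N"
    using assms finite_homog_part_support by (intro submodule_finsum_closed) auto
  then show ?thesis
    using sum_homog_part[OF assms(2) finite_homog_part_support[OF assms(2)]] by simp
qed

text \<open>
  The submodule of the elements all of whose homogeneous parts have y-degree at least b.  It contains
  y^T M when M itself starts in y-degree b - T, and so it stands in for the powers of the ideal Q.
\<close>

definition ydeg_ge :: "int \<Rightarrow> 'b set" where
  "ydeg_ge b = {u \<in> carrier M. \<forall>d. snd d < b \<longrightarrow> homog_part u d = \<zero>}"

lemma ydeg_ge_add: "u \<in> ydeg_ge b \<Longrightarrow> v \<in> ydeg_ge b \<Longrightarrow> u \<oplus> v \<in> ydeg_ge b"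
  by (auto simp: ydeg_ge_def homog_part_add)

lemma ydeg_ge_zero: "\<zero> \<in> ydeg_ge b"
  by (simp add: ydeg_ge_def homog_part_zero)

lemma ydeg_ge_smult_homog:
  assumes "p \<in> bipoly_homog m n e" "u \<in> ydeg_ge b"
  shows "p \<odot> u \<in> ydeg_ge (b + snd e)"
proof -
  have p: "p \<in> carrier S" using assms(1) by (simp add: bipoly_homog_def)
  have u: "u \<in> carrier M" using assms(2) by (simp add: ydeg_ge_def)
  have "homog_part (p \<odot> u) d = \<zero>" if "snd d < b + snd e" for d
  proof -
    have "snd (d - e) < b" using that by simp
    then have "homog_part u (d - e) = \<zero>" using assms(2) unfolding ydeg_ge_def by blast
    then show ?thesis using homog_part_smult[OF assms(1) u] p by simp
  qed
  then show ?thesis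
    using p u unfolding ydeg_ge_def by blast
qed

lemma single_homog:
  assumes "Poly_Mapping.keys t \<subseteq> Inl ` {..<m} \<union> Inr ` {..<n}"
  shows "Poly_Mapping.single t c \<in> bipoly_homog m n (int (xdeg t), int (ydeg t))"
  using assms by (auto simp: bipoly_homog_def bipoly_ring_def split: if_splits)

lemma poly_eq_sum_singles:
  "p = (\<Sum>t\<in>Poly_Mapping.keys p. Poly_Mapping.single t (Poly_Mapping.lookup p t))"
  by (rule poly_mapping_eqI) (auto simp: lookup_sum lookup_single when_def in_keys_iff)

text \<open>
  Homogeneous polynomials only raise the y-degree, and every polynomial is a sum of terms.
\<close>

lemma ydeg_ge_smult:
  assumes p: "p \<in> carrier S" and u: "u \<in> ydeg_ge b"
  shows "p \<odot> u \<in> ydeg_ge b"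
proof -
  let ?single = "\<lambda>t. Poly_Mapping.single t (Poly_Mapping.lookup p t)"
  have uM: "u \<in> carrier M" using u by (simp add: ydeg_ge_def)
  have "sum ?single T \<in> carrier S \<and> sum ?single T \<odot> u \<in> ydeg_ge b"
    if "finite T" "T \<subseteq> Poly_Mapping.keys p" for T
    using that
  proof (induction T)
    case empty
    have z: "0 = \<zero>\<^bsub>S\<^esub>" by (simp add: bipoly_ring_def)
    show ?case using uM by (simp only: sum.empty z R.zero_closed smult_l_null ydeg_ge_zero)
  next
    case (insert t T)
    have "Poly_Mapping.keys t \<subseteq> Inl ` {..<m} \<union> Inr ` {..<n}"
      using p insert.prems by (auto simp: bipoly_ring_def)
    then have t: "?single t \<in> bipoly_homog m n (int (xdeg t), int (ydeg t))"
      by (rule single_homog)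
    then have tS: "?single t \<in> carrier S" by (simp add: bipoly_homog_def)
    have "?single t \<odot> u \<in> ydeg_ge (b + int (ydeg t))"
      using ydeg_ge_smult_homog[OF t u] by simp
    then have tu: "?single t \<odot> u \<in> ydeg_ge b"
      by (auto simp: ydeg_ge_def)
    have IH: "sum ?single T \<in> carrier S" "sum ?single T \<odot> u \<in> ydeg_ge b"
      using insert by auto
    have eq: "sum ?single (insert t T) = ?single t \<oplus>\<^bsub>S\<^esub> sum ?single T"
      using insert.hyps by (simp add: bipoly_ring_def)
    show ?case
      unfolding eq using tS IH tu uM ydeg_ge_add by (simp add: smult_l_distr)
  qed
  from this[OF finite_keys subset_refl] show ?thesis
    using poly_eq_sum_singles[of p] by simp
qed

lemma ydeg_ge_submodule: "submodule (ydeg_ge b) S M"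
proof (rule submoduleI)
  show "ydeg_ge b \<subseteq> carrier M" by (auto simp: ydeg_ge_def)
  show "\<ominus> u \<in> ydeg_ge b" if u: "u \<in> ydeg_ge b" for u
  proof -
    have "(\<ominus>\<^bsub>S\<^esub> \<one>\<^bsub>S\<^esub>) \<odot> u \<in> ydeg_ge b" using u by (intro ydeg_ge_smult) auto
    moreover have "u \<in> carrier M" using u by (simp add: ydeg_ge_def)
    ultimately show ?thesis by (simp add: smult_l_minus)
  qed
qed (auto intro: ydeg_ge_add ydeg_ge_zero ydeg_ge_smult)

text \<open>
  Finitely many generators have finitely many non-zero homogeneous parts.  With b the minimum of
  their y-degrees and of 0 (so that it exists), the submodule of y-degrees at least b contains all
  generators.
\<close>

lemma carrier_eq_ydeg_ge:
  assumes "fin_gen_module S M"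
  obtains b where "carrier M = ydeg_ge b"
proof -
  obtain A where A: "finite A" "A \<subseteq> carrier M" "\<Inter>{N. submodule N S M \<and> A \<subseteq> N} = carrier M"
    using assms unfolding fin_gen_module_def by blast
  define X where "X = (\<Union>a\<in>A. {d. homog_part a d \<noteq> \<zero>})"
  have X: "finite X" unfolding X_def using A finite_homog_part_support by blast
  define b where "b = Min (insert 0 (snd ` X))"
  have "A \<subseteq> ydeg_ge b"
  proof
    fix a assume a: "a \<in> A"
    have "homog_part a d = \<zero>" if "snd d < b" for d
    proof (rule ccontr)
      assume "homog_part a d \<noteq> \<zero>"
      then have "d \<in> X" using a by (auto simp: X_def)
      then have "b \<le> snd d" unfolding b_def using X by (intro Min_le) auto
      then show False using that by simp
    qed
    then show "a \<in> ydeg_ge b" using a A by (auto simp: ydeg_ge_def)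
  qed
  then have "carrier M \<subseteq> ydeg_ge b"
    using A(3) ydeg_ge_submodule by blast
  then show thesis using that by (auto simp: ydeg_ge_def)
qed

lemma yvar_homog:
  assumes "j < n"
  shows "(yvar j :: 'k bipoly) \<in> bipoly_homog m n (0, 1)"
proof -
  let ?t = "Poly_Mapping.single (Inr j) 1 :: monom"
  have "{Inr j} \<inter> range Inl = ({} :: (nat + nat) set)" "{Inr j} \<inter> range Inr = ({Inr j} :: (nat + nat) set)"
    by auto
  then have "xdeg ?t = 0" "ydeg ?t = 1"
    by (simp_all add: xdeg_def ydeg_def)
  moreover have "Poly_Mapping.keys ?t \<subseteq> Inl ` {..<m} \<union> Inr ` {..<n}" using assms by simp
  ultimately show ?thesis
    using single_homog[of ?t 1] by (simp add: yvar_def)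
qed

lemma yvar_closed: "j < n \<Longrightarrow> (yvar j :: 'k bipoly) \<in> carrier S"
  using yvar_homog by (simp add: bipoly_homog_def)

lemma ydeg_ge_yvar_power:
  assumes "j < n" "u \<in> ydeg_ge b"
  shows "(yvar j [^]\<^bsub>S\<^esub> T) \<odot> u \<in> ydeg_ge (b + int T)"
proof (induction T)
  case 0
  then show ?case using assms by (simp add: ydeg_ge_def)
next
  case (Suc T)
  have u: "u \<in> carrier M" using assms by (simp add: ydeg_ge_def)
  have "(yvar j [^]\<^bsub>S\<^esub> Suc T) \<odot> u = yvar j \<odot> ((yvar j [^]\<^bsub>S\<^esub> T) \<odot> u)"
    using u yvar_closed[OF assms(1)] by (simp add: smult_assoc1[symmetric] R.m_comm)
  then show ?case
    using ydeg_ge_smult_homog[OF yvar_homog[OF assms(1)] Suc.IH] by (simp add: ac_simps)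
qed

sublocale module_sequence S M "Q_gens n"
  by unfold_locales (auto simp: Q_gens_def yvar_closed)

lemma Q_gens_idx: "idx = {..<n}" "j < n \<Longrightarrow> Q_gens n ! j = yvar j"
  unfolding idx_def by (simp_all add: Q_gens_def)

lemma power_sum_in_ydeg_ge:
  assumes "carrier M = ydeg_ge b" "v \<in> idx \<rightarrow> carrier M"
  shows "(\<Oplus>j\<in>idx. (Q_gens n ! j) [^]\<^bsub>S\<^esub> T \<odot> v j) \<in> ydeg_ge (b + int T)"
  using assms ydeg_ge_submodule
  by (intro submodule_finsum_closed) (auto simp: Q_gens_idx intro!: ydeg_ge_yvar_power)

text \<open>
  The graded substitute for Krull's intersection theorem in the quotient by A: the part of u of degree
  d is not affected by the error w once w lives in y-degrees above that of d, so it lies in A.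
\<close>

lemma mem_bigraded_submodule_if_approximable:
  assumes A: "bigraded_submodule m n M G A" and u: "u \<in> carrier M"
    and approx: "\<And>T. \<exists>a\<in>A. \<exists>w\<in>ydeg_ge (b + int T). u = a \<oplus> w"
  shows "u \<in> A"
proof (rule submodule_memI[OF _ u])
  show sub: "submodule A S M" using A by (simp add: bigraded_submodule_def)
  fix d :: "int \<times> int"
  \<comment> \<open>the exponent is the least natural T with y-degree of d smaller than b + T\<close>
  obtain a w where a: "a \<in> A" and w: "w \<in> ydeg_ge (b + int (nat (snd d - b + 1)))" and eq: "u = a \<oplus> w"
    using approx by blast
  have c: "a \<in> carrier M" "w \<in> carrier M"
    using a w submoduleE(1)[OF sub] by (auto simp: ydeg_ge_def)
  have "snd d < b + int (nat (snd d - b + 1))" by simp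
  then have "homog_part w d = \<zero>" using w unfolding ydeg_ge_def by blast
  then have "homog_part u d = homog_part a d" using c by (simp add: eq homog_part_add)
  then show "homog_part u d \<in> A" using homog_part_bigraded_submodule[OF A a] by simp
qed

text \<open>
  By the vanishing gap every element of D is, for each T, the sum of an element of A and a combination
  of the y_j^T, and the latter has y-degrees beyond any given bound.
\<close>

lemma bigraded_submodule_subset_of_cd_gap:
  assumes fg: "fin_gen_module S M"
    and A: "bigraded_submodule m n M G A" and B: "submodule B S M" and AB: "A \<subseteq> B"
    and D: "submodule D S M" and DB: "D \<subseteq> B"
    and lcD: "\<And>i. c \<le> i \<Longrightarrow> \<not> lc_nonzero S (Q_gens n) (M\<lparr>carrier := D\<rparr>) i"
    and lcQ: "\<And>i. i < c \<Longrightarrow> \<not> lc_nonzero S (Q_gens n) (module_quot (M\<lparr>carrier := B\<rparr>) A) i"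
  shows "D \<subseteq> A"
proof
  fix x assume x: "x \<in> D"
  obtain b where b: "carrier M = ydeg_ge b" using fg by (rule carrier_eq_ydeg_ge)
  have A': "submodule A S M" using A by (simp add: bigraded_submodule_def)
  interpret B: module_sequence S "M\<lparr>carrier := B\<rparr>" "Q_gens n" using B by (rule module_sequence_submodule)
  interpret incl: module_sequence_hom S "M\<lparr>carrier := B\<rparr>" M "Q_gens n" "\<lambda>x. x"
    using B by (rule submodule_inclusion_hom_carrier)
  show "x \<in> A"
  proof (rule mem_bigraded_submodule_if_approximable[OF A, where b = b])
    show xM: "x \<in> carrier M" using x submoduleE(1)[OF D] by auto
    fix T :: nat
    have "\<exists>a\<in>A. \<exists>v\<in>idx \<rightarrow> carrier (M\<lparr>carrier := B\<rparr>).
        x = a \<oplus>\<^bsub>M\<lparr>carrier := B\<rparr>\<^esub> (\<Oplus>\<^bsub>M\<lparr>carrier := B\<rparr>\<^esub>j\<in>idx. (Q_gens n ! j) [^]\<^bsub>S\<^esub> T \<odot>\<^bsub>M\<lparr>carrier := B\<rparr>\<^esub> v j)"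
    proof (rule B.submodule_elem_power_approx[OF _ _ _ lcQ x])
      show "submodule A S (M\<lparr>carrier := B\<rparr>)" using A' B AB by (rule submodule_restrict)
      show "submodule D S (M\<lparr>carrier := B\<rparr>)" using D B DB by (rule submodule_restrict)
      show "\<not> lc_nonzero S (Q_gens n) (M\<lparr>carrier := B, carrier := D\<rparr>) i" if "c \<le> i" for i
        using lcD[OF that] by simp
    qed
    then obtain a v where a: "a \<in> A" and v: "v \<in> idx \<rightarrow> B"
      and eq: "x = a \<oplus> (\<Oplus>\<^bsub>M\<lparr>carrier := B\<rparr>\<^esub>j\<in>idx. (Q_gens n ! j) [^]\<^bsub>S\<^esub> T \<odot> v j)"
      by auto
    have "(\<Oplus>\<^bsub>M\<lparr>carrier := B\<rparr>\<^esub>j\<in>idx. (Q_gens n ! j) [^]\<^bsub>S\<^esub> T \<odot> v j) = (\<Oplus>j\<in>idx. (Q_gens n ! j) [^]\<^bsub>S\<^esub> T \<odot> v j)"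
    proof (rule incl.hom_finsum[OF finite_idx])
      show "(\<lambda>j. (Q_gens n ! j) [^]\<^bsub>S\<^esub> T \<odot> v j) \<in> idx \<rightarrow> carrier (M\<lparr>carrier := B\<rparr>)"
        using v by (auto intro!: submoduleE(4)[OF B] R.nat_pow_closed ys_nth_closed)
    qed
    with eq have "x = a \<oplus> (\<Oplus>j\<in>idx. (Q_gens n ! j) [^]\<^bsub>S\<^esub> T \<odot> v j)" by (rule trans[OF _ arg_cong])
    moreover have "v \<in> idx \<rightarrow> carrier M" using v submoduleE(1)[OF B] by auto
    ultimately show "\<exists>a\<in>A. \<exists>w\<in>ydeg_ge (b + int T). x = a \<oplus> w"
      by (intro bexI[OF _ a] bexI[OF _ power_sum_in_ydeg_ge[OF b]])
  qed
qed

end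


section \<open>Cohomological dimension along filtrations\<close>

lemma lc_zero_if_cd_less:
  assumes "cd R ys P < ereal (real c)" "c \<le> i"
  shows "\<not> lc_nonzero R ys P i"
proof
  assume "lc_nonzero R ys P i"
  then have "ereal (real i) \<le> cd R ys P" unfolding cd_def by (intro Sup_upper) auto
  then have "ereal (real i) < ereal (real c)" using assms(1) by (rule le_less_trans)
  then show False using assms(2) by simp
qed

lemma cd_le_if_lc_zero:
  assumes "\<And>i. c < i \<Longrightarrow> \<not> lc_nonzero R ys P i"
  shows "cd R ys P \<le> ereal (real c)"
  unfolding cd_def using assms by (intro Sup_least) (force simp: not_less[symmetric])

lemma cd_relative_CM:
  assumes "relative_CM R ys P"
  obtains c where "cd R ys P = ereal (real c)" "\<forall>i. lc_nonzero R ys P i \<longleftrightarrow> i = c"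
proof -
  obtain c where c: "\<And>i. lc_nonzero R ys P i \<longleftrightarrow> i = c"
    using assms unfolding relative_CM_def by metis
  then have "{ereal (real i) |i. lc_nonzero R ys P i} = {ereal (real c)}" by auto
  then show thesis using that[of c] c by (simp add: cd_def)
qed


lemma bigraded_filtrationD:
  assumes "bigraded_filtration m n M G F"
  shows "F ! 0 = {\<zero>\<^bsub>M\<^esub>}" "last F = carrier M" "F \<noteq> []"
    and "i < length F \<Longrightarrow> bigraded_submodule m n M G (F ! i)"
    and "i < length F \<Longrightarrow> submodule (F ! i) (bipoly_ring m n) M"
    and "Suc i < length F \<Longrightarrow> F ! i \<subset> F ! Suc i"
  using assms by (auto simp: bigraded_filtration_def bigraded_submodule_def)

context bigraded
begin

lemma lc_zero_zero_submodule: "\<not> lc_nonzero S (Q_gens n) (M\<lparr>carrier := {\<zero>}\<rparr>) i"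
proof -
  have "submodule {\<zero>} S M" by (rule submoduleI) auto
  then interpret Z: module_sequence S "M\<lparr>carrier := {\<zero>}\<rparr>" "Q_gens n"
    by (rule module_sequence_submodule)
  show ?thesis by (rule Z.lc_zero_trivial) simp
qed

text \<open>
  F_{p+1} is an iterated extension of the quotients F_{j+1} / F_j with j at most p, and their
  cohomological dimensions increase with j.
\<close>

lemma CM_filtration_lc_zero:
  assumes F: "CM_filtration m n M G F" and "Suc p < length F"
    and "cd_Q m n (filt_quot M F p) < ereal (real i)"
  shows "\<not> lc_nonzero S (Q_gens n) (M\<lparr>carrier := F ! Suc p\<rparr>) i"
  using assms(2,3)
proof (induction p)
  have bF: "bigraded_filtration m n M G F" using F by (simp add: CM_filtration_def)
  have step: "\<not> lc_nonzero S (Q_gens n) (M\<lparr>carrier := F ! Suc p\<rparr>) i"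
    if p: "Suc p < length F" and q: "cd_Q m n (filt_quot M F p) < ereal (real i)"
      and prev: "\<not> lc_nonzero S (Q_gens n) (M\<lparr>carrier := F ! p\<rparr>) i" for p
  proof -
    have sub: "submodule (F ! p) S M" "submodule (F ! Suc p) S M" "F ! p \<subseteq> F ! Suc p"
      using bigraded_filtrationD(5)[OF bF] bigraded_filtrationD(6)[OF bF p] p by auto
    interpret N: module_sequence S "M\<lparr>carrier := F ! Suc p\<rparr>" "Q_gens n"
      using sub(2) by (rule module_sequence_submodule)
    show ?thesis
    proof (rule N.lc_zero_extension)
      show "submodule (F ! p) S (M\<lparr>carrier := F ! Suc p\<rparr>)" using sub by (rule submodule_restrict)
      show "\<not> lc_nonzero S (Q_gens n) (M\<lparr>carrier := F ! Suc p, carrier := F ! p\<rparr>) i"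
        using prev by simp
      show "\<not> lc_nonzero S (Q_gens n) (module_quot (M\<lparr>carrier := F ! Suc p\<rparr>) (F ! p)) i"
        using q lc_zero_if_cd_less[of S "Q_gens n" _ i i] by (simp add: cd_Q_def filt_quot_def)
    qed
  qed
  {
    case 0
    then show ?case
      using step lc_zero_zero_submodule bigraded_filtrationD(1)[OF bF] by simp
  next
    case (Suc p)
    then have "cd_Q m n (filt_quot M F p) < cd_Q m n (filt_quot M F (Suc p))"
      using F by (simp add: CM_filtration_def)
    then have "\<not> lc_nonzero S (Q_gens n) (M\<lparr>carrier := F ! Suc p\<rparr>) i"
      using Suc.prems less_trans by (intro Suc.IH) auto
    with Suc.prems show ?case by (intro step[of "Suc p"])
  }
qed

text \<open>
  The upper bound comes from the iterated extension.  If the dimension were smaller than that of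
  the quotient, the projection of F_{p+1} onto the quotient would have a vanishing gap and be zero,
  although F_p is a proper submodule of F_{p+1}.
\<close>

lemma cd_CM_filtration_term:
  assumes fg: "fin_gen_module S M" and F: "CM_filtration m n M G F" and p: "Suc p < length F"
  shows "cd_Q m n (M\<lparr>carrier := F ! Suc p\<rparr>) = cd_Q m n (filt_quot M F p)"
proof -
  have bF: "bigraded_filtration m n M G F" using F by (simp add: CM_filtration_def)
  have "CM_Q m n (filt_quot M F p)" using F p by (simp add: CM_filtration_def)
  then obtain c where c: "cd_Q m n (filt_quot M F p) = ereal (real c)"
    and lc: "\<forall>i. lc_nonzero S (Q_gens n) (filt_quot M F p) i \<longleftrightarrow> i = c"
    unfolding CM_Q_def cd_Q_def by (rule cd_relative_CM)
  have "cd_Q m n (M\<lparr>carrier := F ! Suc p\<rparr>) \<le> ereal (real c)"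
    unfolding cd_Q_def
    using CM_filtration_lc_zero[OF F p] c by (intro cd_le_if_lc_zero) simp
  moreover have "\<not> cd_Q m n (M\<lparr>carrier := F ! Suc p\<rparr>) < ereal (real c)"
  proof
    assume less: "cd_Q m n (M\<lparr>carrier := F ! Suc p\<rparr>) < ereal (real c)"
    have "F ! Suc p \<subseteq> F ! p"
    proof (rule bigraded_submodule_subset_of_cd_gap[OF fg, where c = c and B = "F ! Suc p"])
      show "\<not> lc_nonzero S (Q_gens n) (M\<lparr>carrier := F ! Suc p\<rparr>) i" if "c \<le> i" for i
        using less that unfolding cd_Q_def by (rule lc_zero_if_cd_less)
      show "\<not> lc_nonzero S (Q_gens n) (module_quot (M\<lparr>carrier := F ! Suc p\<rparr>) (F ! p)) i" if "i < c" for i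
        using lc that by (simp add: filt_quot_def)
    qed (use bigraded_filtrationD(4,5)[OF bF] bigraded_filtrationD(6)[OF bF p] p in auto)
    then show False using bigraded_filtrationD(6)[OF bF p] by blast
  qed
  ultimately show ?thesis using c by simp
qed

text \<open>
  Equality of a term of one filtration with a term of the other passes to the terms just below,
  by the gap argument in one direction and by maximality in the other.
\<close>

lemma filtrations_eq_below:
  assumes fg: "fin_gen_module S M" and F: "CM_filtration m n M G F" and D: "dimension_filtration m n M G D"
    and "p < length F" "q < length D" "F ! p = D ! q"
  shows "p = q \<and> (\<forall>i\<le>p. F ! i = D ! i)"
  using assms(4-6)
proof (induction p arbitrary: q)
  have bF: "bigraded_filtration m n M G F" using F by (simp add: CM_filtration_def)
  have bD: "bigraded_filtration m n M G D" using D by (simp add: dimension_filtration_def)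
  have zero_in: "\<zero> \<in> N" if "submodule N S M" for N
    using subgroup.one_closed[OF submodule.axioms(1)[OF that]] by simp
  {
    case (0 q)
    have "q = 0"
    proof (cases q)
      case (Suc r)
      then have "D ! r \<subset> {\<zero>}" "\<zero> \<in> D ! r"
        using bigraded_filtrationD(5,6)[OF bD, of r] bigraded_filtrationD(1)[OF bF] 0 zero_in by simp_all
      then show ?thesis by blast
    qed
    then show ?case using 0 by simp
  next
    case (Suc p)
    have "q \<noteq> 0"
    proof
      assume "q = 0"
      then have "F ! p \<subset> {\<zero>}" "\<zero> \<in> F ! p"
        using bigraded_filtrationD(5,6)[OF bF, of p] bigraded_filtrationD(1)[OF bD] Suc.prems zero_in by simp_all
      then show False by blast
    qed
    then obtain r where q: "q = Suc r" by (cases q) auto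
    have r: "Suc r < length D" and top: "F ! Suc p = D ! Suc r" using Suc.prems q by auto
    have cdD: "cd_Q m n (M\<lparr>carrier := D ! r\<rparr>) < cd_Q m n (M\<lparr>carrier := D ! Suc r\<rparr>)"
      and maxD: "\<And>N. bigraded_submodule m n M G N \<Longrightarrow> N \<subseteq> D ! Suc r \<Longrightarrow>
           cd_Q m n (M\<lparr>carrier := N\<rparr>) < cd_Q m n (M\<lparr>carrier := D ! Suc r\<rparr>) \<Longrightarrow> N \<subseteq> D ! r"
      using D r unfolding dimension_filtration_def by blast+
    have cdF: "cd_Q m n (M\<lparr>carrier := D ! Suc r\<rparr>) = cd_Q m n (filt_quot M F p)"
      using cd_CM_filtration_term[OF fg F Suc.prems(1)] top by simp
    have "CM_Q m n (filt_quot M F p)" using F Suc.prems(1) by (simp add: CM_filtration_def)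
    then obtain c where c: "cd_Q m n (filt_quot M F p) = ereal (real c)"
      and lc: "\<forall>i. lc_nonzero S (Q_gens n) (filt_quot M F p) i \<longleftrightarrow> i = c"
      unfolding CM_Q_def cd_Q_def by (rule cd_relative_CM)
    have "D ! r \<subseteq> F ! p"
    proof (rule bigraded_submodule_subset_of_cd_gap[OF fg, where c = c and B = "F ! Suc p"])
      show "\<not> lc_nonzero S (Q_gens n) (M\<lparr>carrier := D ! r\<rparr>) i" if "c \<le> i" for i
        using cdD that unfolding cdF c unfolding cd_Q_def by (rule lc_zero_if_cd_less)
      show "\<not> lc_nonzero S (Q_gens n) (module_quot (M\<lparr>carrier := F ! Suc p\<rparr>) (F ! p)) i" if "i < c" for i
        using lc that by (simp add: filt_quot_def)
      show "D ! r \<subseteq> F ! Suc p" using bigraded_filtrationD(6)[OF bD r] top by auto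
      show "F ! p \<subseteq> F ! Suc p" using bigraded_filtrationD(6)[OF bF Suc.prems(1)] by auto
      show "bigraded_submodule m n M G (F ! p)" "submodule (F ! Suc p) S M" "submodule (D ! r) S M"
        using bigraded_filtrationD(4,5)[OF bF] bigraded_filtrationD(5)[OF bD] Suc.prems(1) r by simp_all
    qed
    moreover have "F ! p \<subseteq> D ! r"
    proof (rule maxD)
      show "bigraded_submodule m n M G (F ! p)"
        using bigraded_filtrationD(4)[OF bF] Suc.prems(1) by simp
      show "F ! p \<subseteq> D ! Suc r" using bigraded_filtrationD(6)[OF bF Suc.prems(1)] top by auto
      show "cd_Q m n (M\<lparr>carrier := F ! p\<rparr>) < cd_Q m n (M\<lparr>carrier := D ! Suc r\<rparr>)"
      proof (cases p)
        case 0
        then have "cd_Q m n (M\<lparr>carrier := F ! p\<rparr>) = -\<infinity>"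
          using lc_zero_zero_submodule bigraded_filtrationD(1)[OF bF]
          by (simp add: cd_Q_def cd_def bot_ereal_def)
        then show ?thesis using cdF c by simp
      next
        case (Suc p')
        then have "cd_Q m n (filt_quot M F p') < cd_Q m n (filt_quot M F p)"
          using F Suc.prems(1) by (simp add: CM_filtration_def)
        then show ?thesis
          using cd_CM_filtration_term[OF fg F, of p'] Suc \<open>Suc p < length F\<close> cdF by simp
      qed
    qed
    ultimately have eq: "F ! p = D ! r" by blast
    have "p = r \<and> (\<forall>i\<le>p. F ! i = D ! i)"
      using Suc.prems(1) r eq by (intro Suc.IH) simp_all
    then show ?case using q top le_Suc_eq by auto
  }
qed

end


theorem proposition1p9:
  fixes m n :: nat
    and M :: "('k::field bipoly, 'b) module"
    and G :: "int \<times> int \<Rightarrow> 'b set"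
    and \<F> \<D> :: "'b set list"
  assumes "bigraded_module m n M G"
    and "fin_gen_module (bipoly_ring m n) M"
    and "CM_filtration m n M G \<F>"
    and "dimension_filtration m n M G \<D>"
  shows "\<F> = \<D>"
proof -
  interpret bigraded m n M G using assms(1) by (rule bigraded.intro)
  have bF: "bigraded_filtration m n M G \<F>" using assms(3) by (simp add: CM_filtration_def)
  have bD: "bigraded_filtration m n M G \<D>" using assms(4) by (simp add: dimension_filtration_def)
  have len: "0 < length \<F>" "0 < length \<D>"
    using bigraded_filtrationD(3)[OF bF] bigraded_filtrationD(3)[OF bD] by simp_all
  have "\<F> ! (length \<F> - 1) = \<D> ! (length \<D> - 1)"
    using bigraded_filtrationD(2,3)[OF bF] bigraded_filtrationD(2,3)[OF bD] by (simp add: last_conv_nth)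
  then have "length \<F> - 1 = length \<D> - 1 \<and> (\<forall>i\<le>length \<F> - 1. \<F> ! i = \<D> ! i)"
    using len by (intro filtrations_eq_below[OF assms(2-4)]) simp_all
  moreover from this have "length \<F> = length \<D>" using len by linarith
  ultimately show ?thesis
    by (intro nth_equalityI) auto
qed

end
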